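(* Let $p$ be a prime, let $G$ be a finite $pE$-group that can be generated by three elements, and let $\alpha$ be an endomorphism of $G$. (i) If $\alpha$ is an automorphism of $G$, then $\alpha$ is a central automorphism. (ii) If $\alpha$ is not an automorphism of $G$, then $\operatorname{Im}\alpha\le Z(G)$, where $\operatorname{Im}\alpha$ denotes the image of $\alpha$.
   Context: A group is called an $E$-group if every element commutes with all of its images under endomorphisms of the group. For a prime $p$, a $pE$-group is a $p$-group that is an $E$-group. $Z(G)$ is the center of $G$. An automorphism $\alpha$ of $G$ is central if $g^{-1}\alpha(g)\in Z(G)$ for all $g\in G$. *)

theory Defs
  imports "HOL-Algebra.Algebra"
begin

definition group_center :: "('a, 'b) monoid_scheme \<Rightarrow> 'a set" where
  "group_center G = {z \<in> carrier G. \<forall>g \<in> carrier G. z \<otimes>\<^bsub>G\<^esub> g = g \<otimes>\<^bsub>G\<^esub> z}"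

definition E_group :: "('a, 'b) monoid_scheme \<Rightarrow> bool" where
  "E_group G \<longleftrightarrow> group G \<and>
     (\<forall>\<phi> \<in> hom G G. \<forall>x \<in> carrier G. x \<otimes>\<^bsub>G\<^esub> \<phi> x = \<phi> x \<otimes>\<^bsub>G\<^esub> x)"

text \<open>An element of infinite order has \<open>ord = 0\<close>, which is not a power of a prime; so for
  prime \<open>p\<close> every element of a \<open>p\<close>-group has finite order. The group itself may be infinite.\<close>

definition p_group :: "nat \<Rightarrow> ('a, 'b) monoid_scheme \<Rightarrow> bool" where
  "p_group p G \<longleftrightarrow> group G \<and> (\<forall>x \<in> carrier G. \<exists>n::nat. group.ord G x = p ^ n)"

definition pE_group :: "nat \<Rightarrow> ('a, 'b) monoid_scheme \<Rightarrow> bool" where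
  "pE_group p G \<longleftrightarrow> p_group p G \<and> E_group G"

definition central_automorphism :: "('a, 'b) monoid_scheme \<Rightarrow> ('a \<Rightarrow> 'a) \<Rightarrow> bool" where
  "central_automorphism G \<alpha> \<longleftrightarrow> \<alpha> \<in> iso G G \<and>
     (\<forall>g \<in> carrier G. inv\<^bsub>G\<^esub> g \<otimes>\<^bsub>G\<^esub> \<alpha> g \<in> group_center G)"

end

theory Submission
  imports Defs
begin

text \<open>
  Inner automorphisms make an \<open>E\<close>-group 2-Engel. If \<open>n = p ^ m\<close> is the exponent of the abelianization,
  a homomorphism onto the cyclic group of order \<open>n\<close> followed by \<open>k \<mapsto> u ^ k\<close> is an endomorphism for every
  \<open>u\<close> with \<open>u ^ n = 1\<close>, so all such \<open>u\<close> are central. For three generators this gives class at most 2.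

  Let \<open>G\<close> be nonabelian and let \<open>G / Z(G)\<close> have exponent \<open>q\<close>. Powering by \<open>n\<close> maps \<open>G\<close> to \<open>G'\<close>, and only
  central elements are mapped to \<open>1\<close>. As the alternating form \<open>[x, y]\<close> on three generators has only three
  independent values, this forces the commutators \<open>[b, c]\<close>, \<open>[c, a]\<close>, \<open>[a, b]\<close> to be independent of
  order \<open>q\<close>. Then \<open>[x, \<alpha> x] = 1\<close> for all \<open>x\<close> says that \<open>\<alpha>\<close> is a scalar \<open>\<lambda>\<close> modulo \<open>Z(G)\<close>, and
  \<open>\<alpha> (x ^ n) = (\<alpha> x) ^ n\<close> gives \<open>\<lambda>\<^sup>2 = \<lambda>\<close> modulo \<open>q\<close>, that is, \<open>\<lambda> = 0\<close> or \<open>\<lambda> = 1\<close>.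
\<close>

subsection \<open>Commutators\<close>

text \<open>The independence of the commutators is decided one level below q =
  \<open>P ^ Suc r\<close>. The \<open>P ^ r\<close>-th powers of commutators have order dividing
  \<open>P\<close>, so relations between them are linear algebra over the prime field. In dimension
  three every nonzero bivector is decomposable: a nontrivial combination of \<open>comm b c\<close>,
  \<open>comm c a\<close>, \<open>comm a b\<close> is, at this level and up to a scalar, one
  commutator of two members of another generating triple. Hence it is enough that
  \<open>comm a b [^] (P ^ r)\<close> never vanishes, for whatever generating triple. That is a
  counting argument with the map \<open>x [^] (P ^ (m + r))\<close>. The obstacle is p = 2 with n =
  2, where this map is squaring and need not be a homomorphism. There another endomorphism takes
  over: multiplication by \<open>h\<close> outside the centralizer of \<open>h\<close>. The case
  lambda = 1 also needs an argument that \<alpha> is bijective, since being the identity modulo the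
  centre does not give this at once.\<close>

context group
begin

text \<open>This convention is the one of the derived subgroup in HOL-Algebra, so commutators are
  literally its generators.\<close>

definition comm :: "'a \<Rightarrow> 'a \<Rightarrow> 'a" where
  "comm x y = x \<otimes> y \<otimes> inv x \<otimes> inv y"

lemma cancel_inv_left: "x \<in> carrier G \<Longrightarrow> y \<in> carrier G \<Longrightarrow> inv x \<otimes> (x \<otimes> y) = y"
  by (simp add: m_assoc [symmetric])

lemma cancel_inv_right: "x \<in> carrier G \<Longrightarrow> y \<in> carrier G \<Longrightarrow> x \<otimes> (inv x \<otimes> y) = y"
  by (simp add: m_assoc [symmetric])

lemmas word_simps = m_assoc inv_mult_group cancel_inv_left cancel_inv_right

lemma comm_closed [simp, intro]: "x \<in> carrier G \<Longrightarrow> y \<in> carrier G \<Longrightarrow> comm x y \<in> carrier G"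
  by (simp add: comm_def)

lemma comm_eq_one_iff:
  assumes "x \<in> carrier G" "y \<in> carrier G"
  shows "comm x y = \<one> \<longleftrightarrow> x \<otimes> y = y \<otimes> x"
proof
  assume "comm x y = \<one>"
  then have "comm x y \<otimes> (y \<otimes> x) = y \<otimes> x" using assms by simp
  then show "x \<otimes> y = y \<otimes> x" using assms by (simp add: comm_def word_simps)
next
  assume "x \<otimes> y = y \<otimes> x"
  then show "comm x y = \<one>" using assms by (simp add: comm_def word_simps)
qed

lemma comm_self [simp]: "x \<in> carrier G \<Longrightarrow> comm x x = \<one>"
  by (simp add: comm_eq_one_iff)

lemma comm_one [simp]: "x \<in> carrier G \<Longrightarrow> comm x \<one> = \<one>" "x \<in> carrier G \<Longrightarrow> comm \<one> x = \<one>"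
  by (simp_all add: comm_eq_one_iff)

lemma inv_comm: "x \<in> carrier G \<Longrightarrow> y \<in> carrier G \<Longrightarrow> inv (comm x y) = comm y x"
  by (simp add: comm_def word_simps)

lemma comm_mult_left:
  "\<lbrakk>x \<in> carrier G; y \<in> carrier G; z \<in> carrier G\<rbrakk>
    \<Longrightarrow> comm (x \<otimes> y) z = (x \<otimes> comm y z \<otimes> inv x) \<otimes> comm x z"
  by (simp add: comm_def word_simps)

lemma comm_mult_right:
  "\<lbrakk>x \<in> carrier G; y \<in> carrier G; z \<in> carrier G\<rbrakk>
    \<Longrightarrow> comm x (y \<otimes> z) = comm x y \<otimes> (y \<otimes> comm x z \<otimes> inv y)"
  by (simp add: comm_def word_simps)

lemma comm_inv_left:
  "x \<in> carrier G \<Longrightarrow> y \<in> carrier G \<Longrightarrow> comm (inv x) y = inv x \<otimes> comm y x \<otimes> inv (inv x)"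
  by (simp add: comm_def word_simps)

lemma comm_inv_right:
  "x \<in> carrier G \<Longrightarrow> y \<in> carrier G \<Longrightarrow> comm x (inv y) = inv y \<otimes> comm y x \<otimes> inv (inv y)"
  by (simp add: comm_def word_simps)

lemma conj_eq_comm: "g \<in> carrier G \<Longrightarrow> x \<in> carrier G \<Longrightarrow> g \<otimes> x \<otimes> inv g = comm g x \<otimes> x"
  by (simp add: comm_def word_simps)

lemma commutes_int_pow:
  assumes "x \<otimes> y = y \<otimes> x" "x \<in> carrier G" "y \<in> carrier G"
  shows "x \<otimes> y [^] (i::int) = y [^] i \<otimes> x"
proof (cases i rule: int_cases2)
  case (nonneg n)
  then show ?thesis using group_commutes_pow[of y x n] assms by (simp add: int_pow_int)
next
  case (nonpos n)
  have "y [^] n \<otimes> x = x \<otimes> y [^] n" using group_commutes_pow[of y x n] assms by simp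
  then have "inv (y [^] n) \<otimes> (y [^] n \<otimes> x) \<otimes> inv (y [^] n) = inv (y [^] n) \<otimes> (x \<otimes> y [^] n) \<otimes> inv (y [^] n)"
    by simp
  then show ?thesis using nonpos assms by (simp add: int_pow_neg_int word_simps)
qed

lemma conj_int_pow:
  assumes "g \<in> carrier G" "x \<in> carrier G"
  shows "(g \<otimes> x \<otimes> inv g) [^] (i::int) = g \<otimes> x [^] i \<otimes> inv g"
proof -
  have "(\<lambda>x. g \<otimes> x \<otimes> inv g) \<in> hom G G"
    using assms by (auto intro!: homI simp: word_simps)
  then interpret group_hom G G "\<lambda>x. g \<otimes> x \<otimes> inv g"
    by unfold_locales
  show ?thesis using hom_int_pow[OF assms(2)] by simp
qed

text \<open>Conjugation by \<open>x\<close> sends \<open>y [^] i\<close> to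
  \<open>(comm x y \<otimes> y) [^] i\<close>, and the two factors commute. The last hypothesis will
  hold for all pairs once the 2-Engel law is known.\<close>

lemma comm_int_pow_right:
  assumes "x \<in> carrier G" "y \<in> carrier G" "comm x y \<otimes> y = y \<otimes> comm x y"
  shows "comm x (y [^] (i::int)) = comm x y [^] i"
proof -
  have "comm x (y [^] i) = (x \<otimes> y \<otimes> inv x) [^] i \<otimes> inv (y [^] i)"
    unfolding comm_def using assms by (simp add: conj_int_pow)
  also have "x \<otimes> y \<otimes> inv x = comm x y \<otimes> y" using assms by (simp add: conj_eq_comm)
  also have "(comm x y \<otimes> y) [^] i = comm x y [^] i \<otimes> y [^] i"
    by (rule int_pow_mult_distrib) (use assms in auto)
  finally show ?thesis using assms by (simp add: word_simps)
qed

lemma comm_int_pow_left: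
  assumes "x \<in> carrier G" "y \<in> carrier G" "comm x y \<otimes> x = x \<otimes> comm x y"
  shows "comm (x [^] (i::int)) y = comm x y [^] i"
proof -
  have "x \<otimes> comm x y [^] (-1::int) = comm x y [^] (-1::int) \<otimes> x"
    by (rule commutes_int_pow) (use assms in auto)
  then have *: "comm y x \<otimes> x = x \<otimes> comm y x"
    using int_pow_neg[of "comm x y" 1] inv_comm[of x y] assms(1,2) by simp
  have "comm (x [^] i) y = inv (comm y (x [^] i))" using assms(1,2) by (simp add: inv_comm)
  also have "\<dots> = inv (comm y x [^] i)" using comm_int_pow_right[OF assms(2,1) *] by simp
  also have "\<dots> = comm x y [^] i" using assms(1,2) by (simp add: int_pow_inv[symmetric] inv_comm)
  finally show ?thesis .
qed

lemma normal_conj: "N \<lhd> G \<Longrightarrow> g \<in> carrier G \<Longrightarrow> x \<in> N \<Longrightarrow> g \<otimes> x \<otimes> inv g \<in> N"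
  by (simp add: normal_inv_iff)

lemma comm_mem_normal_flip:
  assumes "subgroup N G" "x \<in> carrier G" "y \<in> carrier G" "comm x y \<in> N"
  shows "comm y x \<in> N"
  using assms by (metis inv_comm subgroup.m_inv_closed)

lemma comm_generate_right:
  assumes N: "N \<lhd> G" and u: "u \<in> carrier G" and S: "S \<subseteq> carrier G"
    and *: "\<And>s. s \<in> S \<Longrightarrow> comm u s \<in> N" and y: "y \<in> generate G S"
  shows "comm u y \<in> N"
proof -
  interpret N: normal N G by fact
  have sub: "subgroup N G" ..
  from y show ?thesis
  proof induction
    case one then show ?case using u by simp
  next
    case (incl h) then show ?case using * by simp
  next
    case (inv h)
    then have h: "h \<in> carrier G" using S by auto
    have "comm h u \<in> N" using comm_mem_normal_flip[OF sub u h] * inv by simp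
    then show ?case using normal_conj[OF N, of "inv h"] u h comm_inv_right[OF u h] by simp
  next
    case (eng h1 h2)
    then have "h1 \<in> carrier G" "h2 \<in> carrier G" using generate_in_carrier[OF S] by auto
    then show ?case using eng u by (simp add: comm_mult_right normal_conj[OF N])
  qed
qed

lemma comm_generate:
  assumes N: "N \<lhd> G" and S: "S \<subseteq> carrier G" and gen: "generate G S = carrier G"
    and *: "\<And>s t. s \<in> S \<Longrightarrow> t \<in> S \<Longrightarrow> comm s t \<in> N"
    and x: "x \<in> carrier G" and y: "y \<in> carrier G"
  shows "comm x y \<in> N"
proof (rule comm_generate_right[OF N x S])
  show "y \<in> generate G S" using y gen by simp
  have sub: "subgroup N G" using N normal_imp_subgroup by blast
  fix s assume s: "s \<in> S"
  then have sc: "s \<in> carrier G" using S by auto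
  have "comm s x \<in> N" using comm_generate_right[OF N sc S, of x] * s x gen by blast
  then show "comm x s \<in> N" using comm_mem_normal_flip[OF sub sc x] by simp
qed

section \<open>The derived subgroup and the centre\<close>

lemma comm_in_derived: "x \<in> carrier G \<Longrightarrow> y \<in> carrier G \<Longrightarrow> comm x y \<in> derived G (carrier G)"
  unfolding derived_def comm_def by (rule generate.incl) auto

lemma derived_subset:
  assumes "subgroup H G" "\<And>x y. x \<in> carrier G \<Longrightarrow> y \<in> carrier G \<Longrightarrow> comm x y \<in> H"
  shows "derived G (carrier G) \<subseteq> H"
  unfolding derived_def
  by (rule generate_subgroup_incl[OF _ assms(1)]) (use assms(2) in \<open>auto simp: comm_def\<close>)

lemma mem_center_iff:
  "z \<in> group_center G \<longleftrightarrow> z \<in> carrier G \<and> (\<forall>g \<in> carrier G. comm z g = \<one>)"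
  by (auto simp: group_center_def comm_eq_one_iff)

lemma center_closed: "z \<in> group_center G \<Longrightarrow> z \<in> carrier G"
  unfolding group_center_def by blast

lemma center_commutes: "z \<in> group_center G \<Longrightarrow> x \<in> carrier G \<Longrightarrow> z \<otimes> x = x \<otimes> z"
  unfolding group_center_def by blast

text \<open>The set is the preimage of the centre of \<open>G Mod N\<close>. The trivial
  \<open>N\<close> yields the centre itself; a cyclic central \<open>N\<close> serves in the step
  from class 3 to class 2.\<close>

lemma normal_comm_mem:
  assumes N: "N \<lhd> G"
  shows "{x \<in> carrier G. \<forall>y \<in> carrier G. comm x y \<in> N} \<lhd> G" (is "?H \<lhd> G")
proof (rule normal_invI)
  interpret N: normal N G by fact
  show "subgroup ?H G"
  proof
    show "?H \<subseteq> carrier G" by auto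
    show "\<one> \<in> ?H" by simp
    fix x y assume "x \<in> ?H" "y \<in> ?H"
    then show "x \<otimes> y \<in> ?H" by (simp add: comm_mult_left normal_conj[OF N])
  next
    fix x assume x: "x \<in> ?H"
    have "comm (inv x) y \<in> N" if "y \<in> carrier G" for y
    proof -
      have "comm y x \<in> N" using x that comm_mem_normal_flip[of N x y] N.is_subgroup by simp
      then show ?thesis using comm_inv_left[of x y] normal_conj[OF N, of "inv x"] x that by simp
    qed
    then show "inv x \<in> ?H" using x by simp
  qed
  fix g x assume g: "g \<in> carrier G" and x: "x \<in> ?H"
  have "comm (g \<otimes> x \<otimes> inv g) y \<in> N" if y: "y \<in> carrier G" for y
  proof -
    have "comm (g \<otimes> x \<otimes> inv g) y = g \<otimes> comm x (inv g \<otimes> y \<otimes> g) \<otimes> inv g"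
      using g x y by (simp add: comm_def word_simps)
    then show ?thesis using g x y normal_conj[OF N g] by simp
  qed
  then show "g \<otimes> x \<otimes> inv g \<in> ?H" using g x by simp
qed

lemma center_subgroup: "subgroup (group_center G) G"
proof -
  have "group_center G = {x \<in> carrier G. \<forall>y \<in> carrier G. comm x y \<in> {\<one>}}"
    by (auto simp: mem_center_iff)
  then show ?thesis using normal_comm_mem[OF one_is_normal] by (simp add: normal_imp_subgroup)
qed

lemma center_int_pow: "z \<in> group_center G \<Longrightarrow> z [^] (i::int) \<in> group_center G"
  by (rule subgroup_int_pow_closed[OF center_subgroup])

lemma normal_if_central: "subgroup H G \<Longrightarrow> H \<subseteq> group_center G \<Longrightarrow> H \<lhd> G"
proof (rule normal_invI)
  fix x h assume H: "H \<subseteq> group_center G" and x: "x \<in> carrier G" and h: "h \<in> H"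
  then have hc: "h \<in> group_center G" by auto
  then have "x \<otimes> h \<otimes> inv x = h"
    using x center_commutes[OF hc x] by (metis center_closed inv_closed m_assoc r_inv r_one)
  then show "x \<otimes> h \<otimes> inv x \<in> H" using h by simp
qed

lemma center_normal: "group_center G \<lhd> G"
  by (simp add: normal_if_central center_subgroup)

lemma center_if_commutes_generators:
  assumes S: "S \<subseteq> carrier G" "generate G S = carrier G" and z: "z \<in> carrier G"
    and *: "\<And>s. s \<in> S \<Longrightarrow> comm z s = \<one>"
  shows "z \<in> group_center G"
  using comm_generate_right[OF one_is_normal z S(1)] * S(2) z by (auto simp: mem_center_iff)

text \<open>The exponents that send \<open>x\<close> into \<open>N\<close> form an ideal of the
  integers. If \<open>i\<close> were in it without being a multiple of \<open>p ^ m\<close>, the gcd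
  with \<open>p ^ m\<close> would put \<open>p ^ (m - 1)\<close> into it.\<close>

lemma prime_pow_dvd_if_int_pow_mem:
  fixes p :: int
  assumes p: "Factorial_Ring.prime p" and N: "subgroup N G" and x: "x \<in> carrier G"
    and pm: "x [^] (p ^ m) \<in> N" and nm: "m > 0 \<Longrightarrow> x [^] (p ^ (m - 1)) \<notin> N"
    and i: "x [^] (i::int) \<in> N"
  shows "p ^ m dvd i"
proof (rule ccontr)
  assume nd: "\<not> p ^ m dvd i"
  define d where "d = gcd (p ^ m) i"
  have pp: "p > 1" using p by (simp add: prime_gt_1_int)
  have "d dvd p ^ m" by (simp add: d_def)
  then obtain k where k: "k \<le> m" "normalize d = p ^ k"
    by (rule divides_primepow[OF p])
  have d: "d = p ^ k" using k(2) pp by (simp add: d_def)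
  have "k < m" using nd d k(1) gcd_dvd2[of "p ^ m" i] unfolding d_def[symmetric]
    by (cases "k = m") auto
  then have "d dvd p ^ (m - 1)" unfolding d by (simp add: le_imp_power_dvd)
  then obtain e where e: "p ^ (m - 1) = d * e" by blast
  obtain u v where uv: "u * p ^ m + v * i = d" unfolding d_def using bezout_int by blast
  have "p ^ (m - 1) = (p ^ m * u + i * v) * e" by (simp only: e uv[symmetric] mult.commute)
  then have "x [^] (p ^ (m - 1)) = ((x [^] (p ^ m)) [^] u \<otimes> (x [^] i) [^] v) [^] e"
    by (simp only: int_pow_pow[OF x] int_pow_mult[OF x, symmetric])
  also have "\<dots> \<in> N"
    by (intro subgroup_int_pow_closed[OF N] subgroup.m_closed[OF N] pm i)
  finally show False using nm \<open>k < m\<close> by simp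
qed

section \<open>Computations modulo a normal subgroup\<close>

lemma quotient_group_hom: "N \<lhd> G \<Longrightarrow> group_hom G (G Mod N) ((#>) N)"
  by (simp add: group_hom_def group_hom_axioms_def normal.factorgroup_is_group normal.r_coset_hom_Mod)

lemma quotient_eq_one_iff:
  "N \<lhd> G \<Longrightarrow> x \<in> carrier G \<Longrightarrow> N #> x = \<one>\<^bsub>G Mod N\<^esub> \<longleftrightarrow> x \<in> N"
  unfolding FactGroup_def
  by (simp, metis coset_join1 coset_join2 normal_imp_subgroup subgroup.subset)

lemma int_pow_mult_mod_normal:
  assumes N: "N \<lhd> G" and xy: "x \<in> carrier G" "y \<in> carrier G" "comm x y \<in> N"
  shows "(x \<otimes> y) [^] (i::int) \<otimes> inv (x [^] i \<otimes> y [^] i) \<in> N"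
proof -
  interpret q: group_hom G "G Mod N" "(#>) N" using quotient_group_hom[OF N] .
  let ?c = "(#>) N"
  have "?c (comm x y) = \<one>\<^bsub>G Mod N\<^esub>" using xy quotient_eq_one_iff[OF N, of "comm x y"] by simp
  moreover have "?c (x \<otimes> y) = ?c (comm x y \<otimes> (y \<otimes> x))"
    using xy by (simp add: comm_def word_simps)
  ultimately have c: "?c x \<otimes>\<^bsub>G Mod N\<^esub> ?c y = ?c y \<otimes>\<^bsub>G Mod N\<^esub> ?c x"
    using xy(1,2) by (metis q.hom_mult q.H.l_one q.hom_closed m_closed comm_closed)
  have "?c ((x \<otimes> y) [^] i) = ?c (x [^] i \<otimes> y [^] i)"
    using xy q.H.int_pow_mult_distrib[OF c, of i] by (simp add: q.hom_int_pow del: mult_FactGroup)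
  then have "?c ((x \<otimes> y) [^] i \<otimes> inv (x [^] i \<otimes> y [^] i)) = \<one>\<^bsub>G Mod N\<^esub>"
    using xy by (simp del: mult_FactGroup)
  then show ?thesis
    using xy quotient_eq_one_iff[OF N, of "(x \<otimes> y) [^] i \<otimes> inv (x [^] i \<otimes> y [^] i)"] by simp
qed

lemma subgroup_mult_powers:
  assumes N: "N \<lhd> G" and y: "y \<in> carrier G"
  shows "subgroup {h \<otimes> y [^] (i::int) |h i. h \<in> N} G" (is "subgroup ?K G")
proof
  interpret N: normal N G by fact
  show "?K \<subseteq> carrier G" using y by auto
  have "\<one> = \<one> \<otimes> y [^] (0::int)" by simp
  then show "\<one> \<in> ?K" using N.one_closed by blast
  fix x z assume "x \<in> ?K" "z \<in> ?K"
  then obtain h i k j where h: "h \<in> N" "k \<in> N" and x: "x = h \<otimes> y [^] (i::int)" and z: "z = k \<otimes> y [^] (j::int)"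
    by blast
  have e: "x \<otimes> z = (h \<otimes> (y [^] i \<otimes> k \<otimes> inv (y [^] i))) \<otimes> y [^] (i + j)"
    using y h by (simp add: x z int_pow_mult word_simps)
  have "h \<otimes> (y [^] i \<otimes> k \<otimes> inv (y [^] i)) \<in> N"
    using h normal_conj[OF N, of "y [^] i" k] y by simp
  with e show "x \<otimes> z \<in> ?K" by (intro CollectI exI conjI)
next
  interpret N: normal N G by fact
  fix x assume "x \<in> ?K"
  then obtain h i where h: "h \<in> N" and x: "x = h \<otimes> y [^] (i::int)" by blast
  have e: "inv x = (inv (y [^] i) \<otimes> inv h \<otimes> inv (inv (y [^] i))) \<otimes> y [^] (-i)"
    using y h by (simp add: x int_pow_neg word_simps)
  have "inv (y [^] i) \<otimes> inv h \<otimes> inv (inv (y [^] i)) \<in> N"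
    using h normal_conj[OF N, of "inv (y [^] i)" "inv h"] y by simp
  with e show "inv x \<in> ?K" by (intro CollectI exI conjI)
qed

lemma int_pow_eq_if_dvd_diff:
  assumes "u \<in> carrier G" "u [^] (n::int) = \<one>" "n dvd i - j"
  shows "u [^] i = u [^] j"
proof -
  obtain k where "i - j = n * k" using assms(3) by (rule dvdE)
  then have "i = n * k + j" by simp
  then show ?thesis using assms by (simp add: int_pow_mult int_pow_pow[symmetric])
qed

lemma quotient_comm_group:
  assumes N: "N \<lhd> G" and comm_N: "\<And>x y. x \<in> carrier G \<Longrightarrow> y \<in> carrier G \<Longrightarrow> comm x y \<in> N"
  shows "comm_group (G Mod N)"
proof (rule group.group_comm_groupI)
  interpret q: group_hom G "G Mod N" "(#>) N" using quotient_group_hom[OF N] .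
  show "group (G Mod N)" by (rule q.H.is_group)
  fix U V assume "U \<in> carrier (G Mod N)" "V \<in> carrier (G Mod N)"
  then obtain x y where x: "x \<in> carrier G" "U = N #> x" and y: "y \<in> carrier G" "V = N #> y"
    unfolding carrier_FactGroup by blast
  have "N #> comm x y = \<one>\<^bsub>G Mod N\<^esub>" using x y comm_N quotient_eq_one_iff[OF N, of "comm x y"] by simp
  moreover have "N #> (x \<otimes> y) = N #> (comm x y \<otimes> (y \<otimes> x))"
    using x y by (simp add: comm_def word_simps)
  ultimately show "U \<otimes>\<^bsub>G Mod N\<^esub> V = V \<otimes>\<^bsub>G Mod N\<^esub> U"
    unfolding x(2) y(2) using x(1) y(1)
    by (metis q.hom_mult q.H.l_one q.hom_closed m_closed comm_closed)
qed

lemma center_mult: "y \<in> group_center G \<Longrightarrow> z \<in> group_center G \<Longrightarrow> y \<otimes> z \<in> group_center G"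
  by (rule subgroup.m_closed[OF center_subgroup])

lemma center_inv: "z \<in> group_center G \<Longrightarrow> inv z \<in> group_center G"
  by (rule subgroup.m_inv_closed[OF center_subgroup])

lemma center_left_commute:
  "x \<in> group_center G \<Longrightarrow> y \<in> carrier G \<Longrightarrow> z \<in> carrier G \<Longrightarrow> x \<otimes> (y \<otimes> z) = y \<otimes> (x \<otimes> z)"
  using center_commutes[of x y] center_closed[of x] m_assoc[of x y z] m_assoc[of y x z] by simp

lemma center_mult_mult:
  assumes "y \<in> group_center G" "x \<in> carrier G" "y' \<in> carrier G" "x' \<in> carrier G"
  shows "x \<otimes> y \<otimes> (x' \<otimes> y') = x \<otimes> x' \<otimes> (y \<otimes> y')"
  using assms center_closed[OF assms(1)] center_left_commute[OF assms(1,4,3)] by (simp add: m_assoc)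

end

subsection \<open>Complements of cyclic subgroups\<close>

text \<open>\<open>P\<close> is an integer because exponents are negated and combined by Bezout
  identities throughout.\<close>

locale finite_p_group = group +
  fixes P :: int
  assumes prime_P: "Factorial_Ring.prime P"
    and finite_G: "finite (carrier G)"
    and pow_P_eq_one: "x \<in> carrier G \<Longrightarrow> \<exists>k. x [^] (P ^ k) = \<one>"
begin

lemma exponent_exists: "\<exists>m. \<forall>x \<in> carrier G. x [^] (P ^ m) = \<one>"
proof -
  obtain k where k: "\<And>x. x \<in> carrier G \<Longrightarrow> x [^] (P ^ k x) = \<one>"
    using pow_P_eq_one by metis
  define m where "m = Max (k ` carrier G)"
  have "x [^] (P ^ m) = \<one>" if x: "x \<in> carrier G" for x
  proof -
    have "k x \<le> m" using x finite_G by (simp add: m_def)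
    then have "P ^ k x dvd P ^ m - 0" by (simp add: le_imp_power_dvd)
    then show ?thesis using int_pow_eq_if_dvd_diff[OF x k[OF x], of "P ^ m" 0] by simp
  qed
  then show ?thesis by blast
qed

text \<open>\<open>H\<close> is maximal among the subgroups that contain \<open>N\<close> and meet the powers of \<open>a\<close> only in \<open>N\<close>.
  If \<open>z [^] P = h \<otimes> a [^] i\<close> with \<open>h \<in> H\<close>, then \<open>P\<close> divides \<open>i\<close>, so \<open>z\<close> can be corrected by a power of
  \<open>a\<close> to an element whose \<open>P\<close>-th power lies in \<open>H\<close>, and this element enlarges \<open>H\<close>.\<close>

lemma complement_mod_exists:
  assumes N: "N \<lhd> G" and comm_N: "\<And>x y. x \<in> carrier G \<Longrightarrow> y \<in> carrier G \<Longrightarrow> comm x y \<in> N"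
    and exp_N: "\<And>x. x \<in> carrier G \<Longrightarrow> x [^] (P ^ m) \<in> N"
    and a: "a \<in> carrier G" and a_N: "\<And>i::int. a [^] i \<in> N \<Longrightarrow> P ^ m dvd i"
  obtains H where "H \<lhd> G" "\<And>i::int. a [^] i \<in> H \<Longrightarrow> P ^ m dvd i"
    "\<And>x. x \<in> carrier G \<Longrightarrow> \<exists>h \<in> H. \<exists>i::int. x = h \<otimes> a [^] i"
proof -
  define F where "F = {H. subgroup H G \<and> N \<subseteq> H \<and> (\<forall>i::int. a [^] i \<in> H \<longrightarrow> P ^ m dvd i)}"
  have "F \<subseteq> Pow (carrier G)" by (auto simp: F_def dest: subgroup.mem_carrier)
  then have "finite F" using finite_G by (simp add: finite_subset)
  moreover have "N \<in> F" using N a_N by (simp add: F_def normal_imp_subgroup)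
  ultimately obtain H where HF: "H \<in> F" and H_max: "\<And>H'. H' \<in> F \<Longrightarrow> H \<subseteq> H' \<Longrightarrow> H = H'"
    using finite_has_maximal[of F] by blast
  have sH: "subgroup H G" and NH: "N \<subseteq> H" and aH: "\<And>i::int. a [^] i \<in> H \<Longrightarrow> P ^ m dvd i"
    using HF by (auto simp: F_def)
  have normal_if: "K \<lhd> G" if K: "subgroup K G" and NK: "N \<subseteq> K" for K
  proof (rule normal_invI[OF K])
    fix g h assume g: "g \<in> carrier G" and h: "h \<in> K"
    then have "h \<in> carrier G" using subgroup.subset[OF K] by auto
    then show "g \<otimes> h \<otimes> inv g \<in> K"
      using conj_eq_comm[of g h] g h subsetD[OF NK comm_N] subgroup.m_closed[OF K] by simp
  qed
  have nH: "H \<lhd> G" using normal_if sH NH by blast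
  define K where "K = {h \<otimes> a [^] (i::int) |h i. h \<in> H}"
  have sK: "subgroup K G" unfolding K_def by (rule subgroup_mult_powers[OF nH a])
  have HK: "H \<subseteq> K"
  proof
    fix h assume h: "h \<in> H"
    then have "h = h \<otimes> a [^] (0::int)" using subgroup.mem_carrier[OF sH] by simp
    then show "h \<in> K" unfolding K_def using h by blast
  qed
  have "a = \<one> \<otimes> a [^] (1::int)" using a by simp
  then have aK: "a \<in> K" unfolding K_def using subgroup.one_closed[OF sH] by blast
  have "x \<in> K" if x: "x \<in> carrier G" for x
  proof (rule ccontr)
    assume xK: "x \<notin> K"
    have m: "m > 0"
    proof (rule ccontr)
      assume "\<not> m > 0"
      then have "x \<in> N" using exp_N[OF x] x by simp
      then show False using xK NH HK by auto
    qed
    obtain k where "x [^] (P ^ k) = \<one>" using pow_P_eq_one[OF x] by blast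
    then have exK: "\<exists>k. x [^] (P ^ k) \<in> K" using subgroup.one_closed[OF sK] by metis
    \<comment> \<open>\<open>z\<close> is the last of the iterated \<open>P\<close>-th powers of
      \<open>x\<close> outside \<open>K\<close>, so \<open>z [^] P\<close> lies in
      \<open>K\<close>.\<close>
    define s where "s = (LEAST k. x [^] (P ^ k) \<in> K)"
    have s: "x [^] (P ^ s) \<in> K" unfolding s_def using exK by (rule LeastI_ex)
    then have "s \<noteq> 0" using xK x by (metis int_pow_1 power_0)
    then obtain s' where s': "s = Suc s'" using not0_implies_Suc by blast
    define z where "z = x [^] (P ^ s')"
    have zc: "z \<in> carrier G" using x by (simp add: z_def)
    have zK: "z \<notin> K" unfolding z_def using not_less_Least[of s' "\<lambda>k. x [^] (P ^ k) \<in> K"] s' s_def by simp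
    have "z [^] P \<in> K" using s x unfolding z_def s' by (simp add: int_pow_pow mult.commute)
    then obtain h i where h: "h \<in> H" and zP: "z [^] P = h \<otimes> a [^] (i::int)" unfolding K_def by blast
    have hc: "h \<in> carrier G" using h subgroup.mem_carrier[OF sH] by simp
    \<comment> \<open>Raising \<open>z [^] P\<close> to this power reaches
      \<open>z [^] (P ^ m)\<close>, which lies in \<open>N\<close>. Modulo \<open>H\<close> it
      equals \<open>a [^] (i * ?q)\<close>, so \<open>P ^ m\<close> divides
      \<open>i * ?q\<close>.\<close>
    let ?q = "P ^ (m - 1)"
    have "(h \<otimes> a [^] i) [^] ?q = z [^] (P ^ m)"
      using zc m by (simp add: zP[symmetric] int_pow_pow power_eq_if)
    then have haH: "(h \<otimes> a [^] i) [^] ?q \<in> H" using exp_N[OF zc] NH by auto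
    have mod: "(h \<otimes> a [^] i) [^] ?q \<otimes> inv (h [^] ?q \<otimes> (a [^] i) [^] ?q) \<in> H"
      using int_pow_mult_mod_normal[OF N hc, of "a [^] i"] comm_N hc a NH by auto
    have "(a [^] i) [^] ?q \<in> H"
    proof -
      have "h [^] ?q \<in> H" using h subgroup_int_pow_closed[OF sH] by blast
      moreover have "(a [^] i) [^] ?q =
        inv (h [^] ?q) \<otimes> (inv ((h \<otimes> a [^] i) [^] ?q \<otimes> inv (h [^] ?q \<otimes> (a [^] i) [^] ?q)) \<otimes> (h \<otimes> a [^] i) [^] ?q)"
        using hc a by (simp add: word_simps)
      ultimately show ?thesis
        using haH mod sH
        by (metis subgroup.m_closed subgroup.m_inv_closed)
    qed
    then have "P ^ m dvd i * ?q" using aH a by (simp add: int_pow_pow)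
    then have "P * ?q dvd i * ?q" using m by (simp add: power_eq_if)
    moreover have "P \<noteq> 0" using prime_P by auto
    ultimately have "P dvd i" by auto
    then obtain e where e: "i = P * e" by blast
    define y where "y = z \<otimes> a [^] (-e)"
    have yc: "y \<in> carrier G" using zc a by (simp add: y_def)
    have "z = y \<otimes> a [^] e" using zc a by (simp add: y_def int_pow_neg word_simps)
    then have yK: "y \<notin> K"
      using zK aK subgroup.m_closed[OF sK] subgroup_int_pow_closed[OF sK] by metis
    have "y [^] P \<otimes> inv (z [^] P \<otimes> (a [^] (-e)) [^] P) \<in> H"
      unfolding y_def using int_pow_mult_mod_normal[OF N zc, of "a [^] (-e)" P] comm_N zc a NH by auto
    moreover have "z [^] P \<otimes> (a [^] (-e)) [^] P = h"
      using hc a by (simp add: zP e int_pow_pow int_pow_neg int_pow_inv word_simps mult.commute)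
    ultimately have "y [^] P \<otimes> inv h \<otimes> h \<in> H" using h subgroup.m_closed[OF sH] by simp
    then have yP: "y [^] P \<in> H" using yc hc by (simp add: word_simps)
    define H2 where "H2 = {h \<otimes> y [^] (i::int) |h i. h \<in> H}"
    have sH2: "subgroup H2 G" unfolding H2_def by (rule subgroup_mult_powers[OF nH yc])
    have HH2: "H \<subseteq> H2"
    proof
      fix h assume h: "h \<in> H"
      then have "h = h \<otimes> y [^] (0::int)" using subgroup.mem_carrier[OF sH] by simp
      then show "h \<in> H2" unfolding H2_def using h by blast
    qed
    have "y = \<one> \<otimes> y [^] (1::int)" using yc by simp
    then have "y \<in> H2" unfolding H2_def using subgroup.one_closed[OF sH] by blast
    then have "H \<noteq> H2" using yK HK by auto
    then have "H2 \<notin> F" using H_max HH2 by blast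
    then obtain i' where i': "a [^] (i'::int) \<in> H2" "\<not> P ^ m dvd i'"
      using sH2 HH2 NH unfolding F_def by auto
    then obtain h' k where h': "h' \<in> H" and ai: "a [^] i' = h' \<otimes> y [^] (k::int)" unfolding H2_def by blast
    have h'c: "h' \<in> carrier G" using h' subgroup.mem_carrier[OF sH] by simp
    have yk: "y [^] k = inv h' \<otimes> a [^] i'" using ai h'c yc by (simp add: cancel_inv_left)
    have "inv h' \<in> K" using h' HK subgroup.m_inv_closed[OF sH] by auto
    then have "y [^] k \<in> K" unfolding yk using aK subgroup.m_closed[OF sK] subgroup_int_pow_closed[OF sK] by metis
    \<comment> \<open>\<open>y\<close> has order exactly \<open>P\<close> modulo \<open>K\<close>,
      as \<open>y\<close> is outside \<open>K\<close> and \<open>y [^] P\<close> is in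
      \<open>H\<close>.\<close>
    then have "P dvd k"
      using prime_pow_dvd_if_int_pow_mem[OF prime_P sK yc, of 1 k] yP HK yK yc by auto
    then obtain l where "k = P * l" by blast
    then have "y [^] k = (y [^] P) [^] l" using yc by (simp add: int_pow_pow)
    then have "y [^] k \<in> H" using yP subgroup_int_pow_closed[OF sH] by metis
    then have "a [^] i' \<in> H" unfolding ai using h' subgroup.m_closed[OF sH] by metis
    then show False using aH i' by blast
  qed
  then have "\<And>x. x \<in> carrier G \<Longrightarrow> \<exists>h \<in> H. \<exists>i::int. x = h \<otimes> a [^] i" unfolding K_def by blast
  then show thesis using that nH aH by blast
qed

text \<open>Modulo the complement \<open>H\<close> the group is cyclic of order
  \<open>P ^ m\<close>, generated by \<open>a\<close>, and \<open>f x\<close> is a chosen exponent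
  of \<open>x\<close> there. Congruences suffice, since \<open>f x\<close> will only be an exponent
  of elements whose \<open>P ^ m\<close>-th power is trivial.\<close>

lemma residue_hom_exists:
  assumes N: "N \<lhd> G" and comm_N: "\<And>x y. x \<in> carrier G \<Longrightarrow> y \<in> carrier G \<Longrightarrow> comm x y \<in> N"
    and exp_N: "\<And>x. x \<in> carrier G \<Longrightarrow> x [^] (P ^ m) \<in> N"
    and a: "a \<in> carrier G" and a_N: "\<And>i::int. a [^] i \<in> N \<Longrightarrow> P ^ m dvd i"
  obtains f :: "'a \<Rightarrow> int"
    where "\<And>x y. x \<in> carrier G \<Longrightarrow> y \<in> carrier G \<Longrightarrow> P ^ m dvd f (x \<otimes> y) - (f x + f y)"
      "P ^ m dvd f a - 1"
proof -
  obtain H where nH: "H \<lhd> G" and aH: "\<And>i::int. a [^] i \<in> H \<Longrightarrow> P ^ m dvd i"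
    and ex: "\<And>x. x \<in> carrier G \<Longrightarrow> \<exists>h \<in> H. \<exists>i::int. x = h \<otimes> a [^] i"
    using complement_mod_exists[OF N comm_N exp_N a a_N] by metis
  interpret H: normal H G by fact
  obtain f :: "'a \<Rightarrow> int" where f: "\<And>x. x \<in> carrier G \<Longrightarrow> \<exists>h \<in> H. x = h \<otimes> a [^] f x"
    using ex by metis
  have uniq: "P ^ m dvd i - j" if h: "h \<in> H" "k \<in> H" and eq: "h \<otimes> a [^] i = k \<otimes> a [^] j" for h k and i j :: int
  proof (rule aH)
    have "inv h \<otimes> (h \<otimes> a [^] i) \<otimes> inv (a [^] j) = inv h \<otimes> (k \<otimes> a [^] j) \<otimes> inv (a [^] j)"
      by (simp only: eq)
    then have "a [^] (i - j) = inv h \<otimes> k" using a h by (simp add: int_pow_diff word_simps)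
    then show "a [^] (i - j) \<in> H" using h by simp
  qed
  show thesis
  proof
    fix x y assume x: "x \<in> carrier G" and y: "y \<in> carrier G"
    obtain h where h: "h \<in> H" "x = h \<otimes> a [^] f x" using f[OF x] by blast
    obtain k where k: "k \<in> H" "y = k \<otimes> a [^] f y" using f[OF y] by blast
    obtain l where l: "l \<in> H" "x \<otimes> y = l \<otimes> a [^] f (x \<otimes> y)" using f[of "x \<otimes> y"] x y by blast
    have "l \<otimes> a [^] f (x \<otimes> y) = (h \<otimes> a [^] f x) \<otimes> (k \<otimes> a [^] f y)"
      by (simp only: l(2)[symmetric] h(2)[symmetric] k(2)[symmetric])
    also have "\<dots> = (h \<otimes> (a [^] f x \<otimes> k \<otimes> inv (a [^] f x))) \<otimes> a [^] (f x + f y)"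
      using a h(1) k(1) by (simp add: int_pow_mult word_simps)
    finally show "P ^ m dvd f (x \<otimes> y) - (f x + f y)"
      by (rule uniq[rotated 2]) (use l(1) h(1) k(1) a normal_conj[OF nH] in auto)
  next
    obtain h where h: "h \<in> H" "a = h \<otimes> a [^] f a" using f[OF a] by blast
    have "h \<otimes> a [^] f a = \<one> \<otimes> a [^] (1::int)" using h(2) a by simp
    then show "P ^ m dvd f a - 1" by (rule uniq[rotated 2]) (use h(1) in auto)
  qed
qed

end

subsection \<open>Nilpotency class\<close>

locale E_p_group = finite_p_group +
  assumes commutes_endo: "\<phi> \<in> hom G G \<Longrightarrow> x \<in> carrier G \<Longrightarrow> x \<otimes> \<phi> x = \<phi> x \<otimes> x"
begin

section \<open>The 2-Engel law and its consequences\<close>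

lemma commutes_conj:
  assumes g: "g \<in> carrier G" and x: "x \<in> carrier G"
  shows "x \<otimes> (g \<otimes> x \<otimes> inv g) = (g \<otimes> x \<otimes> inv g) \<otimes> x"
  by (rule commutes_endo[of "\<lambda>x. g \<otimes> x \<otimes> inv g"])
    (use assms in \<open>auto intro!: homI simp: word_simps\<close>)

lemma comm_comm_right:
  assumes g: "g \<in> carrier G" and x: "x \<in> carrier G"
  shows "comm x (comm g x) = \<one>"
proof -
  have "x \<otimes> comm g x = (x \<otimes> (g \<otimes> x \<otimes> inv g)) \<otimes> inv x"
    using g x by (simp add: comm_def word_simps)
  also have "\<dots> = ((g \<otimes> x \<otimes> inv g) \<otimes> x) \<otimes> inv x"
    by (simp only: commutes_conj[OF g x])
  also have "\<dots> = comm g x \<otimes> x"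
    using g x by (simp add: comm_def word_simps)
  finally show ?thesis using g x by (simp add: comm_eq_one_iff)
qed

lemma comm_comm_left:
  assumes g: "g \<in> carrier G" and x: "x \<in> carrier G"
  shows "comm x (comm x g) = \<one>"
proof -
  have "x \<otimes> comm g x = comm g x \<otimes> x"
    using comm_comm_right[OF g x] g x by (simp add: comm_eq_one_iff)
  then have "x \<otimes> comm g x [^] (-1::int) = comm g x [^] (-1::int) \<otimes> x"
    by (rule commutes_int_pow) (use g x in auto)
  then show ?thesis
    using g x int_pow_neg[of "comm g x" 1] by (simp add: inv_comm comm_eq_one_iff)
qed

lemma comm_int_pow_right': "x \<in> carrier G \<Longrightarrow> y \<in> carrier G \<Longrightarrow> comm x (y [^] (i::int)) = comm x y [^] i"
  using comm_comm_right[of x y] by (intro comm_int_pow_right) (auto simp: comm_eq_one_iff)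

lemma comm_int_pow_left': "x \<in> carrier G \<Longrightarrow> y \<in> carrier G \<Longrightarrow> comm (x [^] (i::int)) y = comm x y [^] i"
  using comm_comm_left[of y x] by (intro comm_int_pow_left) (auto simp: comm_eq_one_iff)

lemma conj_commutes_conj:
  assumes g: "g \<in> carrier G" and h: "h \<in> carrier G" and x: "x \<in> carrier G"
  shows "(g \<otimes> x \<otimes> inv g) \<otimes> (h \<otimes> x \<otimes> inv h) = (h \<otimes> x \<otimes> inv h) \<otimes> (g \<otimes> x \<otimes> inv g)"
proof -
  let ?k = "inv g \<otimes> h"
  have "g \<otimes> (x \<otimes> (?k \<otimes> x \<otimes> inv ?k)) \<otimes> inv g = g \<otimes> ((?k \<otimes> x \<otimes> inv ?k) \<otimes> x) \<otimes> inv g"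
    using commutes_conj[of ?k x] g h x by simp
  then show ?thesis using g h x by (simp add: word_simps)
qed

text \<open>Any two conjugates of \<open>x\<close> commute, because a conjugation moves one of them
  to \<open>x\<close> itself. So the conjugates generate an abelian normal subgroup.\<close>

lemma abelian_normal_closure_exists:
  assumes x: "x \<in> carrier G"
  obtains A where "A \<lhd> G" "x \<in> A" "\<And>n m. n \<in> A \<Longrightarrow> m \<in> A \<Longrightarrow> n \<otimes> m = m \<otimes> n"
proof
  let ?S = "{g \<otimes> x \<otimes> inv g |g. g \<in> carrier G}"
  have S: "?S \<subseteq> carrier G" using x by auto
  show "generate G ?S \<lhd> G"
  proof (rule normal_generateI[OF S])
    fix h g assume "h \<in> ?S" and g: "g \<in> carrier G"
    then obtain k where k: "k \<in> carrier G" "h = k \<otimes> x \<otimes> inv k" by blast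
    have "g \<otimes> h \<otimes> inv g = (g \<otimes> k) \<otimes> x \<otimes> inv (g \<otimes> k)" using k g x by (simp add: word_simps)
    then show "g \<otimes> h \<otimes> inv g \<in> ?S" using g k(1) by (intro CollectI exI[of _ "g \<otimes> k"]) auto
  qed
  have "x = \<one> \<otimes> x \<otimes> inv \<one>" using x by simp
  then have "x \<in> ?S" using one_closed by blast
  then show "x \<in> generate G ?S" by (rule generate.incl)
  have comm_S: "comm s t = \<one>" if "s \<in> ?S" "t \<in> ?S" for s t
  proof -
    from that(1) obtain g where g: "s = g \<otimes> x \<otimes> inv g" "g \<in> carrier G"
      by (elim CollectE exE conjE)
    from that(2) obtain h where h: "t = h \<otimes> x \<otimes> inv h" "h \<in> carrier G"
      by (elim CollectE exE conjE)
    have "s \<in> carrier G" "t \<in> carrier G" using g h x by simp_all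
    moreover have "s \<otimes> t = t \<otimes> s" unfolding g(1) h(1) by (rule conj_commutes_conj[OF g(2) h(2) x])
    ultimately show ?thesis using comm_eq_one_iff by blast
  qed
  have comm_Sn: "comm n s = \<one>" if n: "n \<in> generate G ?S" and s: "s \<in> ?S" for n s
  proof -
    have sc: "s \<in> carrier G" using s S by blast
    have "comm s n \<in> {\<one>}"
      by (rule comm_generate_right[OF one_is_normal sc S _ n]) (use comm_S[OF s] in auto)
    then show ?thesis using inv_comm[of s n] generate_in_carrier[OF S n] sc by simp
  qed
  fix n m assume n: "n \<in> generate G ?S" and m: "m \<in> generate G ?S"
  have c: "n \<in> carrier G" "m \<in> carrier G" using generate_in_carrier[OF S] n m by auto
  have "comm n m \<in> {\<one>}"
    by (rule comm_generate_right[OF one_is_normal c(1) S _ m]) (use comm_Sn[OF n] in auto)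
  then show "n \<otimes> m = m \<otimes> n" using c by (simp add: comm_eq_one_iff)
qed

text \<open>On the abelian normal closure of \<open>x\<close> the operators \<open>D y = comm y\<close> are additive and satisfy
  \<open>D y \<circ> D y = 0\<close>. Since \<open>D (y z) = D y D z + D y + D z\<close>, this forces \<open>D y D z + D z D y = 0\<close>.\<close>

lemma comm_comm_swap:
  assumes x: "x \<in> carrier G" and y: "y \<in> carrier G" and z: "z \<in> carrier G"
  shows "comm z (comm y x) = inv (comm y (comm z x))"
proof -
  obtain A where nA: "A \<lhd> G" and xA: "x \<in> A"
    and cA: "\<And>n m. n \<in> A \<Longrightarrow> m \<in> A \<Longrightarrow> n \<otimes> m = m \<otimes> n"
    using abelian_normal_closure_exists[OF x] by blast
  interpret A: normal A G by fact
  have DA: "comm y n \<in> A" if "y \<in> carrier G" "n \<in> A" for y n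
    unfolding comm_def using normal_conj[OF nA, of y n] that by simp
  have D_add: "comm y (n \<otimes> m) = comm y n \<otimes> comm y m"
    if y: "y \<in> carrier G" and n: "n \<in> A" and m: "m \<in> A" for y n m
  proof -
    have "n \<otimes> comm y m \<otimes> inv n = comm y m \<otimes> n \<otimes> inv n"
      by (simp only: cA[OF n DA[OF y m]])
    also have "\<dots> = comm y m" using n m y by (simp add: m_assoc)
    finally have "n \<otimes> comm y m \<otimes> inv n = comm y m" .
    then show ?thesis using y n m by (simp add: comm_mult_right)
  qed
  have DD: "comm y (comm y n) = \<one>" if "y \<in> carrier G" "n \<in> A" for y n
    using that comm_comm_left[of n y] by simp
  have D_mult: "comm (y \<otimes> z) n = comm y (comm z n) \<otimes> comm z n \<otimes> comm y n"
    if "y \<in> carrier G" "z \<in> carrier G" "n \<in> A" for y z n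
    using that by (simp add: comm_mult_left conj_eq_comm)
  have eq: "comm y (comm z (comm y (comm z n))) \<otimes> comm z (comm y (comm z n)) \<otimes> comm y (comm z n)
      \<otimes> (comm y (comm z (comm y n)) \<otimes> comm z (comm y n)) = \<one>"
    if y: "y \<in> carrier G" and z: "z \<in> carrier G" and n: "n \<in> A" for y z n
  proof -
    have "comm (y \<otimes> z) (comm (y \<otimes> z) n) = \<one>" using DD[of "y \<otimes> z" n] y z n by simp
    then show ?thesis using y z n by (simp add: D_mult D_add DA DD)
  qed
  \<comment> \<open>Applying \<open>D y\<close> to \<open>eq\<close> leaves
    \<open>D y D z D y D z + D y D z D y = 0\<close>. At \<open>comm z n\<close> in place of
    \<open>n\<close> the first summand vanishes, so \<open>D y D z D y D z = 0\<close>, and then the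
    other summand is zero as well.\<close>
  have triple: "comm y (comm z (comm y n)) = \<one>"
    if y: "y \<in> carrier G" and z: "z \<in> carrier G" and n: "n \<in> A" for y z n
  proof -
    have *: "comm y (comm z (comm y (comm z n))) \<otimes> comm y (comm z (comm y n)) = \<one>" if n: "n \<in> A" for n
    proof -
      have "comm y (comm y (comm z (comm y (comm z n))) \<otimes> comm z (comm y (comm z n))
        \<otimes> comm y (comm z n) \<otimes> (comm y (comm z (comm y n)) \<otimes> comm z (comm y n))) = \<one>"
        using eq[OF y z n] y by simp
      then show ?thesis using y z n by (simp add: D_add DA DD)
    qed
    have "comm y (comm z (comm y (comm z n))) = \<one>"
      using *[of "comm z n"] y z n by (simp add: DA DD)
    then show ?thesis using *[OF n] y z n by (simp add: DA)
  qed
  have "comm z (comm y x) \<otimes> comm y (comm z x) = \<one>"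
    using eq[OF z y xA] triple[OF y z] triple[OF z y] y z x xA by (simp add: DA)
  then show ?thesis using x y z inv_equality by simp
qed

text \<open>If \<open>f\<close> maps \<open>G\<close> onto the residues modulo \<open>P ^ m\<close> and \<open>u [^] (P ^ m) = \<one>\<close>, then
  \<open>x \<mapsto> u [^] f x\<close> is an endomorphism, so \<open>u\<close> commutes with all \<open>x\<close> such that \<open>f x\<close> is a unit;
  these \<open>x\<close> generate \<open>G\<close>.\<close>

lemma central_if_pow_exponent_abelianization:
  obtains m where "\<And>x. x \<in> carrier G \<Longrightarrow> x [^] (P ^ m) \<in> derived G (carrier G)"
    "\<And>u. u \<in> carrier G \<Longrightarrow> u [^] (P ^ m) = \<one> \<Longrightarrow> u \<in> group_center G"
proof -
  let ?D = "derived G (carrier G)"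
  have nD: "?D \<lhd> G" by (rule derived_self_is_normal)
  then have sD: "subgroup ?D G" by (rule normal_imp_subgroup)
  define Q where "Q m \<longleftrightarrow> (\<forall>x \<in> carrier G. x [^] (P ^ m) \<in> ?D)" for m
  have "\<exists>m. Q m" using exponent_exists subgroup.one_closed[OF sD] unfolding Q_def by metis
  then have Q: "Q (LEAST m. Q m)" by (rule LeastI_ex)
  define m where "m = (LEAST m. Q m)"
  have exp_D: "x [^] (P ^ m) \<in> ?D" if "x \<in> carrier G" for x
    using Q that by (simp add: m_def Q_def)
  \<comment> \<open>Minimality of \<open>m\<close> supplies an element of order exactly
    \<open>P ^ m\<close> modulo the derived subgroup. For \<open>m = 0\<close> any element will
    do.\<close>
  have "\<exists>a \<in> carrier G. m > 0 \<longrightarrow> a [^] (P ^ (m - 1)) \<notin> ?D"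
  proof (cases "m > 0")
    case True
    then have "\<not> Q (m - 1)" using not_less_Least[of "m - 1" Q] by (simp add: m_def)
    then show ?thesis unfolding Q_def by blast
  qed auto
  then obtain a where a: "a \<in> carrier G" and am: "m > 0 \<Longrightarrow> a [^] (P ^ (m - 1)) \<notin> ?D" by blast
  have aD: "P ^ m dvd i" if "a [^] i \<in> ?D" for i :: int
    by (rule prime_pow_dvd_if_int_pow_mem[OF prime_P sD a exp_D[OF a] am that])
  obtain f :: "'a \<Rightarrow> int"
    where f: "\<And>x y. x \<in> carrier G \<Longrightarrow> y \<in> carrier G \<Longrightarrow> P ^ m dvd f (x \<otimes> y) - (f x + f y)"
      and fa: "P ^ m dvd f a - 1"
    using residue_hom_exists[OF nD comm_in_derived exp_D a aD] by metis
  have "u \<in> group_center G" if u: "u \<in> carrier G" and um: "u [^] (P ^ m) = \<one>" for u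
  proof -
    have f_mult: "u [^] f (x \<otimes> y) = u [^] f x \<otimes> u [^] f y" if "x \<in> carrier G" "y \<in> carrier G" for x y
      using int_pow_eq_if_dvd_diff[OF u um f[OF that]] u by (simp add: int_pow_mult)
    have hom: "(\<lambda>x. u [^] f x) \<in> hom G G" by (rule homI) (use u f_mult in auto)
    have ufa: "u [^] f a = u" using int_pow_eq_if_dvd_diff[OF u um fa] u by simp
    have comm_u: "comm x u = \<one>" if "x \<in> carrier G" "u [^] f x = u" for x
      using commutes_endo[OF hom that(1)] that u by (simp add: comm_eq_one_iff)
    interpret h: group_hom G G "\<lambda>x. u [^] f x" using hom by unfold_locales
    have "comm y u = \<one>" if y: "y \<in> carrier G" for y
    proof -
      \<comment> \<open>Chosen to make \<open>f (z \<otimes> y)\<close> congruent to 1. Then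
        \<open>u\<close> commutes with \<open>z \<otimes> y\<close> and, being a power of
        \<open>a\<close> away, with \<open>y\<close>.\<close>
      define z where "z = a [^] (1 - f y)"
      have zc: "z \<in> carrier G" using a by (simp add: z_def)
      have "u [^] f z = u [^] (1 - f y)" unfolding z_def using h.hom_int_pow[OF a, of "1 - f y"] ufa by simp
      then have "u [^] f (z \<otimes> y) = u [^] (1 - f y + f y)"
        using f_mult[OF zc y] u by (simp only: int_pow_mult)
      then have zy: "comm (z \<otimes> y) u = \<one>" using comm_u[of "z \<otimes> y"] zc y u by simp
      have "comm z u = \<one>"
        using comm_int_pow_left'[OF a u, of "1 - f y"] comm_u[OF a ufa] by (simp add: z_def)
      then have "z \<otimes> comm y u \<otimes> inv z = \<one>" using zy comm_mult_left[OF zc y u] zc y u by simp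
      then have "inv z \<otimes> (z \<otimes> comm y u \<otimes> inv z) \<otimes> z = \<one>" using zc by simp
      then show ?thesis using zc y u by (simp add: word_simps)
    qed
    then have "comm u y = \<one>" if "y \<in> carrier G" for y using inv_comm[OF that u] that by simp
    then show ?thesis using u by (simp add: mem_center_iff)
  qed
  then show thesis using that exp_D by blast
qed

text \<open>Otherwise the centralizer of \<open>h\<close> has index 2 and every element outside it
  inverts \<open>h\<close>. Then \<phi>, which multiplies exactly the outside elements by
  \<open>h\<close>, is an endomorphism, and an outside \<open>y\<close> would have to commute with
  \<open>y \<otimes> h\<close>, hence with \<open>h\<close>. This replaces the power map when that
  fails to be a homomorphism.\<close>

lemma central_if_fixed_or_inverted:
  assumes h: "h \<in> carrier G"
    and *: "\<And>y. y \<in> carrier G \<Longrightarrow> y \<otimes> h = h \<otimes> y \<or> y \<otimes> h = inv h \<otimes> y"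
  shows "h \<in> group_center G"
proof -
  let ?c = "\<lambda>x. x \<otimes> h = h \<otimes> x"
  define \<phi> where "\<phi> x = (if ?c x then x else x \<otimes> h)" for x
  have "?c y" if y: "y \<in> carrier G" for y
  proof (rule ccontr)
    assume nc: "\<not> ?c y"
    then have hh: "inv h \<noteq> h" using * y by metis
    have "\<phi> (x \<otimes> y) = \<phi> x \<otimes> \<phi> y" if x: "x \<in> carrier G" and y: "y \<in> carrier G" for x y
    proof -
      consider "?c x" "?c y" | "?c x" "y \<otimes> h = inv h \<otimes> y" "\<not> ?c y"
        | "x \<otimes> h = inv h \<otimes> x" "\<not> ?c x" "?c y" | "x \<otimes> h = inv h \<otimes> x" "\<not> ?c x" "y \<otimes> h = inv h \<otimes> y" "\<not> ?c y"
        using *[OF x] *[OF y] by blast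
      then show ?thesis
      proof cases
        case 1
        then have "?c (x \<otimes> y)" using x y h by (metis m_assoc)
        then show ?thesis using 1 by (simp add: \<phi>_def)
      next
        case 2
        have "x \<otimes> inv h = inv h \<otimes> x"
          using commutes_int_pow[OF 2(1) x h, of "-1"] h by (simp add: int_pow_neg)
        then have "x \<otimes> y \<otimes> h = inv h \<otimes> (x \<otimes> y)" using 2(2) x y h by (metis inv_closed m_assoc)
        then have "\<not> ?c (x \<otimes> y)" using hh x y h by (metis inv_closed m_closed r_cancel)
        then show ?thesis using 2 x y h by (simp add: \<phi>_def m_assoc)
      next
        case 3
        have "x \<otimes> y \<otimes> h = inv h \<otimes> (x \<otimes> y)" using 3 x y h by (metis inv_closed m_assoc)
        then have "\<not> ?c (x \<otimes> y)" using hh x y h by (metis inv_closed m_closed r_cancel)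
        then have "\<phi> (x \<otimes> y) = x \<otimes> (y \<otimes> h)" using x y h by (simp add: \<phi>_def m_assoc)
        also have "\<dots> = x \<otimes> h \<otimes> y" using 3(3) x y h by (simp add: m_assoc)
        also have "\<dots> = \<phi> x \<otimes> \<phi> y" using 3(2,3) by (simp add: \<phi>_def)
        finally show ?thesis .
      next
        case 4
        have xh: "x \<otimes> inv h = h \<otimes> x"
        proof -
          have "h \<otimes> (x \<otimes> h) \<otimes> inv h = h \<otimes> (inv h \<otimes> x) \<otimes> inv h" by (simp only: 4(1))
          then show ?thesis using x h by (simp add: word_simps)
        qed
        have "x \<otimes> y \<otimes> h = h \<otimes> (x \<otimes> y)" using 4(3) xh x y h by (metis inv_closed m_assoc)
        moreover have "x \<otimes> h \<otimes> (y \<otimes> h) = x \<otimes> y"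
          using 4(3) x y h by (simp add: word_simps)
        ultimately show ?thesis using 4 by (simp add: \<phi>_def)
      qed
    qed
    then have "\<phi> \<in> hom G G" using h by (intro homI) (auto simp: \<phi>_def)
    then have "y \<otimes> \<phi> y = \<phi> y \<otimes> y" using commutes_endo y by blast
    then have "y \<otimes> (y \<otimes> h) = y \<otimes> (h \<otimes> y)" using nc y h by (simp add: \<phi>_def m_assoc)
    then show False using nc y h by simp
  qed
  then show ?thesis using h by (auto simp: group_center_def)
qed

lemma comm_inv_right': "x \<in> carrier G \<Longrightarrow> y \<in> carrier G \<Longrightarrow> comm x (inv y) = comm y x"
  using comm_int_pow_right'[of x y "-1"] by (simp add: int_pow_neg inv_comm)

text \<open>Two inversions cancel: one from flipping the inner commutator, one from
  \<open>comm_comm_swap\<close>. So three generators have only one triple commutator up to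
  inversion.\<close>

lemma comm_comm_rotate:
  assumes x: "x \<in> carrier G" and y: "y \<in> carrier G" and z: "z \<in> carrier G"
  shows "comm x (comm y z) = comm z (comm x y)"
proof -
  have "comm x (comm y z) = comm x (inv (comm z y))" using y z by (simp add: inv_comm)
  also have "\<dots> = inv (comm x (comm z y))"
    using comm_inv_right'[of x "comm z y"] inv_comm[of x "comm z y"] x y z by (simp only: comm_closed)
  also have "\<dots> = comm z (comm x y)" using comm_comm_swap[OF y z x] x y z by simp
  finally show ?thesis .
qed

lemma comm_commutes_comm:
  assumes x: "x \<in> carrier G" and y: "y \<in> carrier G" and z: "z \<in> carrier G"
  shows "comm y x \<otimes> comm z x = comm z x \<otimes> comm y x"
proof -
  obtain A where nA: "A \<lhd> G" and xA: "x \<in> A"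
    and cA: "\<And>n m. n \<in> A \<Longrightarrow> m \<in> A \<Longrightarrow> n \<otimes> m = m \<otimes> n"
    using abelian_normal_closure_exists[OF x] by blast
  interpret A: normal A G by fact
  have "comm y x \<in> A" if "y \<in> carrier G" for y
    unfolding comm_def using normal_conj[OF nA, of y x] that xA by simp
  then show ?thesis using cA y z by blast
qed

text \<open>The triple commutator \<open>t\<close> of the generators is central, and modulo \<open>t\<close> all commutators are
  central. As \<open>x [^] n\<close> lies in the derived subgroup, \<open>comm b c [^] n = t [^] i\<close> and
  \<open>comm a b [^] n = t [^] k\<close>. Then \<open>comm a b [^] i \<otimes> comm c b [^] k\<close> has \<open>n\<close>-th power \<open>\<one>\<close>, so it is
  central, and its commutator with \<open>c\<close> is \<open>t [^] i\<close>.\<close>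

lemma comm_central:
  assumes abc: "a \<in> carrier G" "b \<in> carrier G" "c \<in> carrier G"
    and gen: "generate G {a, b, c} = carrier G"
    and xy: "x \<in> carrier G" "y \<in> carrier G"
  shows "comm x y \<in> group_center G"
proof -
  let ?S = "{a, b, c}"
  have S: "?S \<subseteq> carrier G" using abc by simp
  define t where "t = comm a (comm b c)"
  have tc: "t \<in> carrier G" using abc by (simp add: t_def)
  have t: "comm a (comm b c) = t" "comm b (comm c a) = t" "comm c (comm a b) = t"
    using comm_comm_rotate abc unfolding t_def by metis+
  have t': "comm a (comm c b) = inv t" "comm b (comm a c) = inv t" "comm c (comm b a) = inv t"
    using comm_inv_right'[of a "comm b c"] comm_inv_right'[of b "comm c a"] comm_inv_right'[of c "comm a b"]
      t abc inv_comm by (metis comm_closed)+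
  have triple: "comm r (comm s u) \<in> {\<one>, t, inv t}" if "r \<in> ?S" "s \<in> ?S" "u \<in> ?S" for r s u
    using that t t' abc by (auto simp: comm_comm_left comm_comm_right)
  \<comment> \<open>Rotation brings any generator \<open>s\<close> to the outer position of
    \<open>t\<close>, and \<open>comm s (comm s g)\<close> is trivial by the 2-Engel law.\<close>
  have "comm t s = \<one>" if s: "s \<in> ?S" for s
  proof -
    have "comm s t = \<one>"
      using s comm_comm_left[of "comm b c" a] comm_comm_left[of "comm c a" b] comm_comm_left[of "comm a b" c] t abc
      by auto
    then show ?thesis using inv_comm[of s t] s S tc by auto
  qed
  then have tZ: "t \<in> group_center G" using center_if_commutes_generators[OF S gen tc] by blast
  have central_if: "comm s u \<in> {x \<in> carrier G. \<forall>y \<in> carrier G. comm x y \<in> N}"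
    if N: "N \<lhd> G" and tN: "t \<in> N" and s: "s \<in> ?S" and u: "u \<in> ?S" for N s u
  proof -
    interpret N: normal N G by fact
    have su: "s \<in> carrier G" "u \<in> carrier G" using s u S by auto
    have "comm (comm s u) r \<in> N" if r: "r \<in> ?S" for r
    proof -
      have rc: "r \<in> carrier G" using r S by auto
      have "comm r (comm s u) \<in> N" using triple[OF r s u] tN by auto
      then show ?thesis using comm_mem_normal_flip[OF N.is_subgroup rc] su by simp
    qed
    then show ?thesis using comm_generate_right[OF N _ S] su gen by auto
  qed
  define T where "T = generate G {t}"
  have sT: "subgroup T G" unfolding T_def by (rule generate_is_subgroup) (use tc in auto)
  have tT: "t \<in> T" unfolding T_def by (rule generate.incl) simp
  have "T \<subseteq> group_center G" unfolding T_def by (rule generate_subgroup_incl) (use tZ center_subgroup in auto)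
  then have nT: "T \<lhd> G" by (rule normal_if_central[OF sT])
  have T_pow: "\<exists>i::int. z = t [^] i" if "z \<in> T" for z
    using that generate_pow[OF tc] unfolding T_def by auto
  define Z2 where "Z2 = {x \<in> carrier G. \<forall>y \<in> carrier G. comm x y \<in> T}"
  have nZ2: "Z2 \<lhd> G" unfolding Z2_def by (rule normal_comm_mem[OF nT])
  have "comm x y \<in> Z2" if "x \<in> carrier G" "y \<in> carrier G" for x y
    by (rule comm_generate[OF nZ2 S gen _ that]) (use central_if[OF nT tT] in \<open>auto simp: Z2_def\<close>)
  then have DZ2: "derived G (carrier G) \<subseteq> Z2"
    using derived_subset[OF normal_imp_subgroup[OF nZ2]] by blast
  obtain m where pow_D: "\<And>x. x \<in> carrier G \<Longrightarrow> x [^] (P ^ m) \<in> derived G (carrier G)"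
    and omega: "\<And>u. u \<in> carrier G \<Longrightarrow> u [^] (P ^ m) = \<one> \<Longrightarrow> u \<in> group_center G"
    using central_if_pow_exponent_abelianization by blast
  define n where "n = P ^ m"
  have comm_n: "\<exists>i::int. comm x y [^] n = t [^] i" if x: "x \<in> carrier G" and y: "y \<in> carrier G" for x y
  proof -
    have "comm (x [^] n) y \<in> T" using pow_D[OF x] DZ2 y unfolding n_def Z2_def by auto
    then show ?thesis using T_pow comm_int_pow_left'[OF x y] by auto
  qed
  obtain i where i: "comm b c [^] n = t [^] (i::int)" using comm_n abc by blast
  obtain k where k: "comm a b [^] n = t [^] (k::int)" using comm_n abc by blast
  define U where "U = comm a b [^] i"
  define V where "V = comm c b [^] k"
  have UV: "U \<in> carrier G" "V \<in> carrier G" using abc by (simp_all add: U_def V_def)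
  have "U \<otimes> comm c b = comm c b \<otimes> U"
    unfolding U_def using comm_commutes_comm[OF abc(2,3,1)] commutes_int_pow[of "comm c b" "comm a b" i] abc by simp
  then have "U \<otimes> V = V \<otimes> U" unfolding V_def by (rule commutes_int_pow) (use UV abc in auto)
  then have "(U \<otimes> V) [^] n = U [^] n \<otimes> V [^] n" using UV by (rule int_pow_mult_distrib)
  also have "U [^] n = t [^] (k * i)"
    using abc tc k by (simp add: U_def int_pow_pow mult.commute[of i n]) (simp add: int_pow_pow[symmetric] tc)
  also have "V [^] n = (inv (comm b c) [^] n) [^] k"
    using abc by (simp add: V_def int_pow_pow mult.commute inv_comm)
  also have "\<dots> = inv (t [^] (k * i))"
    using abc i tc by (simp add: int_pow_inv int_pow_pow mult.commute)
  finally have "(U \<otimes> V) [^] n = \<one>" using tc by simp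
  then have "U \<otimes> V \<in> group_center G" using omega UV by (simp add: n_def)
  then have "comm (U \<otimes> V) c = \<one>" using abc by (simp add: mem_center_iff)
  then have "comm c (U \<otimes> V) = \<one>" using inv_comm[of "U \<otimes> V" c] UV abc by simp
  moreover have "comm c U = t [^] i"
    unfolding U_def using comm_int_pow_right'[of c "comm a b" i] t(3) abc by simp
  moreover have "comm c V = \<one>"
    unfolding V_def using comm_int_pow_right'[of c "comm c b" k] comm_comm_left[of b c] abc by simp
  ultimately have "t [^] i = \<one>" using comm_mult_right[of c U V] UV abc tc by simp
  then have "comm b c [^] n = \<one>" using i by simp
  then have "comm b c \<in> group_center G" using omega abc by (simp add: n_def)
  then have "comm (comm b c) a = \<one>" using abc by (simp add: mem_center_iff)
  then have "t = \<one>" using inv_comm[of "comm b c" a] abc by (simp add: t_def)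
  then have "comm s u \<in> group_center G" if "s \<in> ?S" "u \<in> ?S" for s u
    using central_if[OF one_is_normal _ that] abc by (simp add: mem_center_iff)
  then show ?thesis by (rule comm_generate[OF center_normal S gen _ xy])
qed

end

subsection \<open>Independence of the commutators\<close>

text \<open>\<open>P ^ m\<close> is the n and \<open>P ^ Suc r\<close> the q of the overview. The
  successor expresses that \<open>G\<close> is nonabelian and makes \<open>P ^ r\<close> the
  exponent that sends commutators to elements of order dividing \<open>P\<close>.\<close>

locale class_two_E_p_group = E_p_group +
  fixes m r :: nat
  assumes comm_center [simp]: "x \<in> carrier G \<Longrightarrow> y \<in> carrier G \<Longrightarrow> comm x y \<in> group_center G"
    and pow_derived: "x \<in> carrier G \<Longrightarrow> x [^] (P ^ m) \<in> derived G (carrier G)"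
    and central_if_pow: "x \<in> carrier G \<Longrightarrow> x [^] (P ^ m) = \<one> \<Longrightarrow> x \<in> group_center G"
    and pow_center: "x \<in> carrier G \<Longrightarrow> x [^] (P ^ Suc r) \<in> group_center G"
    and pow_not_center: "\<exists>x \<in> carrier G. x [^] (P ^ r) \<notin> group_center G"
begin

lemma P_gt_1: "P > 1"
  using prime_P by (simp add: prime_gt_1_int)

lemma comm_mult_left':
  assumes "x \<in> carrier G" "y \<in> carrier G" "z \<in> carrier G"
  shows "comm (x \<otimes> y) z = comm x z \<otimes> comm y z"
proof -
  have "x \<otimes> comm y z \<otimes> inv x = comm y z"
    using assms center_commutes[of "comm y z" x] by (metis comm_center comm_closed inv_closed m_assoc r_inv r_one)
  then show ?thesis using assms center_commutes[of "comm y z" "comm x z"] by (simp add: comm_mult_left)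
qed

lemma comm_mult_right':
  assumes "x \<in> carrier G" "y \<in> carrier G" "z \<in> carrier G"
  shows "comm x (y \<otimes> z) = comm x y \<otimes> comm x z"
proof -
  have "y \<otimes> comm x z \<otimes> inv y = comm x z"
    using assms center_commutes[of "comm x z" y] by (metis comm_center comm_closed inv_closed m_assoc r_inv r_one)
  then show ?thesis using assms by (simp add: comm_mult_right)
qed

lemma comm_commute:
  "\<lbrakk>x \<in> carrier G; y \<in> carrier G; z \<in> carrier G\<rbrakk> \<Longrightarrow> comm x y \<otimes> z = z \<otimes> comm x y"
  using center_commutes[OF comm_center] .

lemma comm_mult_int_pow:
  assumes "x \<in> carrier G" "y \<in> carrier G" "z \<in> carrier G"
  shows "(comm x y \<otimes> z) [^] (i::int) = comm x y [^] i \<otimes> z [^] i"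
  by (rule int_pow_mult_distrib) (use assms comm_commute in auto)

lemma center_mult_int_pow:
  assumes "x \<in> carrier G" "z \<in> group_center G"
  shows "(x \<otimes> z) [^] (i::int) = x [^] i \<otimes> z [^] i"
  by (rule int_pow_mult_distrib) (use assms center_commutes center_closed in auto)

lemma comm_center_left: "z \<in> group_center G \<Longrightarrow> y \<in> carrier G \<Longrightarrow> comm z y = \<one>"
  by (simp add: mem_center_iff)

lemma comm_center_right: "z \<in> group_center G \<Longrightarrow> y \<in> carrier G \<Longrightarrow> comm y z = \<one>"
  using inv_comm[of z y] by (simp add: mem_center_iff)

lemma pow_center_iff:
  assumes "x \<in> carrier G"
  shows "x [^] (i::int) \<in> group_center G \<longleftrightarrow> (\<forall>y \<in> carrier G. comm x y [^] i = \<one>)"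
  using assms by (simp add: mem_center_iff comm_int_pow_left')

lemma comm_pow_exponent: "x \<in> carrier G \<Longrightarrow> y \<in> carrier G \<Longrightarrow> comm x y [^] (P ^ Suc r) = \<one>"
  using pow_center pow_center_iff by blast

lemma comm_pow_eq:
  "x \<in> carrier G \<Longrightarrow> y \<in> carrier G \<Longrightarrow> P ^ Suc r dvd i - j \<Longrightarrow> comm x y [^] i = comm x y [^] j"
  by (rule int_pow_eq_if_dvd_diff[OF _ comm_pow_exponent]) auto

lemma derived_center: "derived G (carrier G) \<subseteq> group_center G"
  by (rule derived_subset[OF center_subgroup]) simp

text \<open>\<open>P ^ m\<close>-th powers are products of commutators and hence central, so q
  divides \<open>P ^ m\<close>.\<close>

lemma Suc_r_le_m: "Suc r \<le> m"
proof (rule ccontr)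
  assume "\<not> Suc r \<le> m"
  then have "P ^ m dvd P ^ r" by (simp add: le_imp_power_dvd)
  then obtain e where e: "P ^ r = P ^ m * e" by blast
  have "x [^] (P ^ r) \<in> group_center G" if "x \<in> carrier G" for x
    using pow_derived[OF that] derived_center center_int_pow that unfolding e
    by (metis int_pow_pow subsetD)
  then show False using pow_not_center by blast
qed

lemma exists_comm_pow_ne_one: "\<exists>x \<in> carrier G. \<exists>y \<in> carrier G. comm x y [^] (P ^ r) \<noteq> \<one>"
  using pow_not_center pow_center_iff by blast

lemma comm_flip_pow: "x \<in> carrier G \<Longrightarrow> y \<in> carrier G \<Longrightarrow> comm x y [^] (i::int) = comm y x [^] (- i)"
  by (simp add: int_pow_neg int_pow_inv[symmetric] inv_comm)

section \<open>Words in three generators\<close>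

text \<open>The exponents are ordered as in the cross product: the commutator of \<open>word a b c\<close> at \<open>v\<close> and
  at \<open>w\<close> is \<open>comm_word a b c\<close> at \<open>v \<times> w\<close>.\<close>

definition word :: "'a \<Rightarrow> 'a \<Rightarrow> 'a \<Rightarrow> int \<Rightarrow> int \<Rightarrow> int \<Rightarrow> 'a" where
  "word a b c i j k = a [^] i \<otimes> b [^] j \<otimes> c [^] k"

definition comm_word :: "'a \<Rightarrow> 'a \<Rightarrow> 'a \<Rightarrow> int \<Rightarrow> int \<Rightarrow> int \<Rightarrow> 'a" where
  "comm_word a b c i j k = comm b c [^] i \<otimes> comm c a [^] j \<otimes> comm a b [^] k"

context
  fixes a b c
  assumes abc [simp]: "a \<in> carrier G" "b \<in> carrier G" "c \<in> carrier G"
begin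

lemma word_closed [simp]: "word a b c i j k \<in> carrier G"
  by (simp add: word_def)

lemma comm_word_center [simp]: "comm_word a b c i j k \<in> group_center G"
  by (simp add: comm_word_def center_mult center_int_pow)

lemma comm_word_closed [simp]: "comm_word a b c i j k \<in> carrier G"
  by (simp add: comm_word_def)

lemma comm_word_mult:
  "comm_word a b c i j k \<otimes> comm_word a b c i' j' k' = comm_word a b c (i + i') (j + j') (k + k')"
  unfolding comm_word_def
  by (subst center_mult_mult, simp_all add: center_int_pow)
    (subst center_mult_mult, simp_all add: center_int_pow int_pow_mult)

lemma comm_word_int_pow:
  "comm_word a b c i j k [^] e = comm_word a b c (i * e) (j * e) (k * e)"
proof -
  have "comm_word a b c i j k [^] e = (comm b c [^] i \<otimes> comm c a [^] j) [^] e \<otimes> (comm a b [^] k) [^] e"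
    unfolding comm_word_def by (rule center_mult_int_pow) (simp_all add: center_int_pow)
  also have "(comm b c [^] i \<otimes> comm c a [^] j) [^] e = (comm b c [^] i) [^] e \<otimes> (comm c a [^] j) [^] e"
    by (rule center_mult_int_pow) (simp_all add: center_int_pow)
  finally show ?thesis by (simp add: comm_word_def int_pow_pow)
qed

lemma comm_word_rotate: "comm_word b c a j k i = comm_word a b c i j k"
  by (simp add: comm_word_def m_assoc center_int_pow center_commutes[of "comm b c [^] i"])

lemma comm_word_left: "g \<in> carrier G \<Longrightarrow>
    comm (word a b c i j k) g = comm a g [^] i \<otimes> comm b g [^] j \<otimes> comm c g [^] k"
  by (simp add: word_def comm_mult_left' comm_int_pow_left')

lemma comm_word_gen:
  "comm (word a b c i j k) a = comm_word a b c 0 k (- j)"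
  "comm (word a b c i j k) b = comm_word a b c (- k) 0 i"
  "comm (word a b c i j k) c = comm_word a b c j (- i) 0"
  unfolding comm_word_left[OF abc(1)] comm_word_left[OF abc(2)] comm_word_left[OF abc(3)]
  using comm_flip_pow[of b a j] comm_flip_pow[of c b k] comm_flip_pow[of a c i]
  by (simp_all add: comm_word_def center_commutes center_int_pow)

end

text \<open>For generators \<open>a\<close>, \<open>b\<close>, \<open>c\<close> this is the derived
  subgroup in coordinates. The coordinates turn out to be unique modulo q.\<close>

definition comm_words :: "'a \<Rightarrow> 'a \<Rightarrow> 'a \<Rightarrow> 'a set" where
  "comm_words a b c = {z. \<exists>i j k. z = comm_word a b c i j k}"

context
  fixes a b c
  assumes abc [simp]: "a \<in> carrier G" "b \<in> carrier G" "c \<in> carrier G"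
    and gen: "generate G {a, b, c} = carrier G"
begin

lemma comm_words_normal: "comm_words a b c \<lhd> G"
proof (rule normal_if_central)
  show "comm_words a b c \<subseteq> group_center G" by (auto simp: comm_words_def)
  show "subgroup (comm_words a b c) G"
  proof
    show "comm_words a b c \<subseteq> carrier G" by (auto simp: comm_words_def)
    have "\<one> = comm_word a b c 0 0 0" by (simp add: comm_word_def)
    then show "\<one> \<in> comm_words a b c" unfolding comm_words_def by blast
  next
    fix x y assume "x \<in> comm_words a b c" "y \<in> comm_words a b c"
    then show "x \<otimes> y \<in> comm_words a b c"
      unfolding comm_words_def using comm_word_mult[OF abc] by blast
  next
    fix x assume "x \<in> comm_words a b c"
    then obtain i j k where x: "x = comm_word a b c i j k" unfolding comm_words_def by blast
    have "inv x = x [^] (-1::int)" by (simp add: x int_pow_neg)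
    also have "\<dots> = comm_word a b c (i * -1) (j * -1) (k * -1)"
      unfolding x by (rule comm_word_int_pow[OF abc])
    finally show "inv x \<in> comm_words a b c" unfolding comm_words_def by blast
  qed
qed

lemma comm_in_comm_words:
  assumes "x \<in> carrier G" "y \<in> carrier G"
  shows "comm x y \<in> comm_words a b c"
proof (rule comm_generate[OF comm_words_normal _ gen _ assms])
  fix s t assume s: "s \<in> {a, b, c}" and t: "t \<in> {a, b, c}"
  have "a = word a b c 1 0 0" "b = word a b c 0 1 0" "c = word a b c 0 0 1"
    by (simp_all add: word_def)
  then obtain i j k where "s = word a b c i j k" using s by blast
  then show "comm s t \<in> comm_words a b c"
    using t comm_word_gen[OF abc, of i j k] unfolding comm_words_def by auto
qed auto

lemma derived_subset_comm_words: "derived G (carrier G) \<subseteq> comm_words a b c"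
  by (rule derived_subset[OF normal_imp_subgroup[OF comm_words_normal] comm_in_comm_words])

text \<open>The quotient by \<open>comm_words a b c\<close> is abelian, so exponents of the
  generators can be collected there.\<close>

lemma word_decomposition:
  assumes x: "x \<in> carrier G"
  obtains i j k d where "d \<in> comm_words a b c" "x = word a b c i j k \<otimes> d"
proof -
  let ?N = "comm_words a b c"
  interpret q: group_hom G "G Mod ?N" "(#>) ?N" using quotient_group_hom[OF comm_words_normal] .
  interpret Q: comm_group "G Mod ?N" by (rule quotient_comm_group[OF comm_words_normal comm_in_comm_words])
  define \<pi> where "\<pi> = (#>) ?N"
  have \<pi>: "group_hom G (G Mod ?N) \<pi>" unfolding \<pi>_def by (rule q.group_hom_axioms)
  then interpret \<pi>: group_hom G "G Mod ?N" \<pi> .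
  have w: "\<pi> (word a b c i j k) = \<pi> a [^]\<^bsub>G Mod ?N\<^esub> i \<otimes>\<^bsub>G Mod ?N\<^esub> \<pi> b [^]\<^bsub>G Mod ?N\<^esub> j \<otimes>\<^bsub>G Mod ?N\<^esub> \<pi> c [^]\<^bsub>G Mod ?N\<^esub> k" for i j k
    by (simp only: word_def \<pi>.hom_mult \<pi>.hom_int_pow int_pow_closed m_closed abc)
  have w_add: "\<pi> (word a b c i j k) \<otimes>\<^bsub>G Mod ?N\<^esub> \<pi> (word a b c i' j' k') = \<pi> (word a b c (i + i') (j + j') (k + k'))"
    for i j k i' j' k'
    unfolding w using \<pi>.hom_closed[OF abc(1)] \<pi>.hom_closed[OF abc(2)] \<pi>.hom_closed[OF abc(3)]
    by (simp only: q.H.int_pow_mult Q.m_ac q.H.int_pow_closed q.H.m_closed)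
  have ww: "word a b c 1 0 0 = a" "word a b c 0 1 0 = b" "word a b c 0 0 1 = c"
    "word a b c (-1) 0 0 = inv a" "word a b c 0 (-1) 0 = inv b" "word a b c 0 0 (-1) = inv c"
    "word a b c 0 0 0 = \<one>"
    by (simp_all add: word_def int_pow_neg)
  have "x \<in> generate G {a, b, c}" using x gen by simp
  then have "\<exists>i j k. \<pi> x = \<pi> (word a b c i j k)"
  proof induction
    case one then show ?case using ww by metis
  next
    case (incl h) then show ?case using ww by (metis insertE emptyE)
  next
    case (inv h) then show ?case using ww by (metis insertE emptyE)
  next
    case (eng h1 h2)
    then have "h1 \<in> carrier G" "h2 \<in> carrier G" using gen by auto
    then show ?case using eng w_add \<pi>.hom_mult by metis
  qed
  then obtain i j k where ijk: "\<pi> x = \<pi> (word a b c i j k)" by blast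
  define d where "d = inv (word a b c i j k) \<otimes> x"
  have "\<pi> d = \<one>\<^bsub>G Mod ?N\<^esub>"
    unfolding d_def using x ijk abc \<pi>.hom_closed[of "word a b c i j k"]
    by (simp only: \<pi>.hom_mult \<pi>.hom_inv inv_closed word_closed q.H.l_inv)
  then have "d \<in> ?N"
    using quotient_eq_one_iff[OF comm_words_normal, of d] x unfolding d_def \<pi>_def by simp
  moreover have "x = word a b c i j k \<otimes> d" using x by (simp add: d_def cancel_inv_right)
  ultimately show thesis using that by blast
qed

lemma comm_word_decomposition:
  assumes "d \<in> comm_words a b c" "g \<in> carrier G"
  shows "comm (word a b c i j k \<otimes> d) g = comm a g [^] i \<otimes> comm b g [^] j \<otimes> comm c g [^] k"
proof -
  have d: "d \<in> group_center G" using assms(1) by (auto simp: comm_words_def)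
  then show ?thesis
    using assms(2) by (simp add: comm_mult_left' center_closed comm_center_left comm_word_left)
qed

end

lemma pow_center_if_comm_generators:
  assumes S: "S \<subseteq> carrier G" "generate G S = carrier G" and x: "x \<in> carrier G"
    and *: "\<And>s. s \<in> S \<Longrightarrow> comm x s [^] (i::int) = \<one>"
  shows "x [^] i \<in> group_center G"
  by (rule center_if_commutes_generators[OF S]) (use * S x comm_int_pow_left' in auto)

text \<open>By bilinearity all commutators would have trivial \<open>P ^ r\<close>-th power, so the
  exponent of \<open>G\<close> modulo its centre would divide \<open>P ^ r\<close>.\<close>

lemma pow_trivial_contradiction:
  assumes S: "S \<subseteq> carrier G" "generate G S = carrier G"
    and *: "\<And>s t. s \<in> S \<Longrightarrow> t \<in> S \<Longrightarrow> comm s t [^] (P ^ r) = \<one>"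
  shows False
proof -
  have "s [^] (P ^ r) \<in> group_center G" if "s \<in> S" for s
    by (rule pow_center_if_comm_generators[OF S]) (use * S that in auto)
  then have 1: "comm s x [^] (P ^ r) = \<one>" if "s \<in> S" "x \<in> carrier G" for s x
    using that S pow_center_iff by blast
  have "x [^] (P ^ r) \<in> group_center G" if x: "x \<in> carrier G" for x
  proof (rule pow_center_if_comm_generators[OF S x])
    fix s assume s: "s \<in> S"
    then have "comm x s [^] (P ^ r) = inv (comm s x [^] (P ^ r))"
      using S x comm_flip_pow[of x s "P ^ r"] by (auto simp: int_pow_neg)
    then show "comm x s [^] (P ^ r) = \<one>" using 1[OF s x] by simp
  qed
  then show False using pow_not_center by blast
qed

section \<open>The power map\<close>

lemma mult_nat_pow:
  assumes x: "x \<in> carrier G" and y: "y \<in> carrier G"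
  shows "(x \<otimes> y) [^] (n::nat) = x [^] n \<otimes> y [^] n \<otimes> comm y x [^] (n choose 2)"
proof (induction n)
  case (Suc n)
  let ?k = "comm y x"
  have "y [^] n \<otimes> x = x \<otimes> y [^] n \<otimes> ?k [^] n"
  proof -
    have "y [^] n \<otimes> x = comm (y [^] n) x \<otimes> (x \<otimes> y [^] n)"
      using x y by (simp add: comm_def word_simps)
    also have "comm (y [^] n) x = ?k [^] n" using comm_int_pow_left'[OF y x, of "int n"] by (simp add: int_pow_int)
    also have "?k [^] n \<otimes> (x \<otimes> y [^] n) = x \<otimes> y [^] n \<otimes> ?k [^] n"
      using center_commutes[OF center_int_pow[OF comm_center[OF y x], of "int n"]] x y by (simp add: int_pow_int)
    finally show ?thesis .
  qed
  note yx = this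
  have kz: "?k [^] l \<otimes> g = g \<otimes> ?k [^] l" if "g \<in> carrier G" for g and l :: nat
    using center_commutes[OF center_int_pow[OF comm_center[OF y x], of "int l"] that] by (simp add: int_pow_int)
  have "(x \<otimes> y) [^] Suc n = x [^] n \<otimes> (y [^] n \<otimes> (?k [^] (n choose 2) \<otimes> (x \<otimes> y)))"
    using x y by (simp add: Suc.IH m_assoc)
  also have "\<dots> = x [^] n \<otimes> ((y [^] n \<otimes> x) \<otimes> y \<otimes> ?k [^] (n choose 2))"
    using x y kz[of "x \<otimes> y"] by (simp add: m_assoc)
  also have "\<dots> = x [^] n \<otimes> x \<otimes> y [^] n \<otimes> (?k [^] n \<otimes> y) \<otimes> ?k [^] (n choose 2)"
    using x y by (simp add: yx m_assoc)
  also have "\<dots> = x [^] Suc n \<otimes> y [^] Suc n \<otimes> (?k [^] n \<otimes> ?k [^] (n choose 2))"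
    using x y kz[of y n] by (simp add: m_assoc)
  also have "?k [^] n \<otimes> ?k [^] (n choose 2) = ?k [^] (Suc n choose 2)"
    using x y by (simp add: nat_pow_mult numeral_2_eq_2)
  finally show ?case .
qed (use x y in \<open>simp add: numeral_2_eq_2\<close>)

text \<open>If this fails, \<open>x \<mapsto> x [^] (P ^ (m + r))\<close> need not be a homomorphism.\<close>

definition regular :: bool where
  "regular \<longleftrightarrow> \<not> (P = 2 \<and> m = 1)"

text \<open>The correction factor is a commutator raised to the binomial coefficient of
  \<open>P ^ (m + r)\<close> over 2. This is a multiple of q: for odd \<open>P\<close> because
  \<open>m \<ge> 1\<close>, and for \<open>P = 2\<close>, where one factor 2 is lost, because
  \<open>m \<ge> 2\<close>.\<close>

lemma power_map_mult:
  assumes reg: regular and x: "x \<in> carrier G" and y: "y \<in> carrier G"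
  shows "(x \<otimes> y) [^] (P ^ (m + r)) = x [^] (P ^ (m + r)) \<otimes> y [^] (P ^ (m + r))"
proof -
  define n where "n = nat (P ^ (m + r))"
  have n: "int n = P ^ (m + r)" using P_gt_1 by (simp add: n_def)
  have "P ^ Suc r dvd int (n choose 2)"
  proof -
    have e2: "2 * int (n choose 2) = int n * (int n - 1)"
    proof -
      have "even (n * (n - 1))" by (cases "even n") auto
      then have "2 * (n choose 2) = n * (n - 1)" by (simp add: choose_two)
      then have "int (2 * (n choose 2)) = int (n * (n - 1))" by (simp only:)
      moreover have "n \<ge> 1" using n P_gt_1 by (metis of_nat_1 of_nat_le_iff one_le_power less_imp_le)
      ultimately show ?thesis by (simp add: of_nat_diff)
    qed
    show ?thesis
    proof (cases "P = 2")
      case True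
      then have "m \<ge> 2" using reg Suc_r_le_m unfolding regular_def by auto
      then have "int n = 2 * (P ^ Suc r * 2 ^ (m - 2))"
        unfolding n True by (auto simp: power_add dest!: le_Suc_ex)
      then have "int (n choose 2) = P ^ Suc r * 2 ^ (m - 2) * (int n - 1)" using e2 by simp
      then show ?thesis by simp
    next
      case False
      then have "coprime (P ^ Suc r) 2"
        using primes_coprime[OF prime_P, of 2] by simp
      moreover have "P ^ Suc r dvd 2 * int (n choose 2)"
        unfolding e2 n using Suc_r_le_m by (intro dvd_mult2 le_imp_power_dvd) simp
      ultimately show ?thesis using coprime_dvd_mult_right_iff by blast
    qed
  qed
  then have "comm y x [^] int (n choose 2) = \<one>"
    using comm_pow_eq[OF y x, of "int (n choose 2)" 0] by simp
  then show ?thesis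
    using mult_nat_pow[OF x y, of n] x y unfolding n[symmetric] by (simp add: int_pow_int)
qed

lemma power_map_int_pow:
  assumes reg: regular and x: "x \<in> carrier G" and y: "y \<in> carrier G"
  shows "(x [^] (i::int) \<otimes> y [^] (j::int)) [^] (P ^ (m + r))
    = (x [^] (P ^ (m + r))) [^] i \<otimes> (y [^] (P ^ (m + r))) [^] j"
  using power_map_mult[OF reg, of "x [^] i" "y [^] j"] x y by (simp add: int_pow_pow mult.commute)

lemma power_map_kernel:
  assumes x: "x \<in> carrier G" and "x [^] (P ^ (m + r)) = \<one>"
  shows "x [^] (P ^ r) \<in> group_center G"
  using central_if_pow[of "x [^] (P ^ r)"] assms by (simp add: int_pow_pow power_add mult.commute)

lemma not_regular: "\<not> regular \<Longrightarrow> P = 2 \<and> m = 1 \<and> r = 0"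
  using Suc_r_le_m unfolding regular_def by auto

lemma pow_reduce:
  assumes "x \<in> carrier G" "y \<in> carrier G" "\<not> P dvd j" "(comm x y [^] (P ^ r)) [^] (j::int) = z [^] (i::int)"
    and z: "z \<in> carrier G"
  obtains k :: int where "comm x y [^] (P ^ r) = z [^] k"
proof -
  have "coprime P j" using prime_P assms(3) by (rule prime_imp_coprime)
  then obtain u v where uv: "u * P + v * j = 1" using bezout_int[of P j] by auto
  have 1: "comm x y [^] (P ^ r * P) = \<one>" using comm_pow_exponent[OF assms(1,2)] by (simp add: mult.commute)
  have "P ^ r = P ^ r * (u * P + v * j)" by (simp only: uv mult_1_right)
  also have "\<dots> = (P ^ r * P) * u + (P ^ r * j) * v" by (simp add: algebra_simps)
  finally have "comm x y [^] (P ^ r) = comm x y [^] ((P ^ r * P) * u + (P ^ r * j) * v)" by (rule arg_cong)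
  also have "\<dots> = (comm x y [^] (P ^ r * P)) [^] u \<otimes> ((comm x y [^] (P ^ r)) [^] j) [^] v"
    using assms(1,2) by (simp only: int_pow_mult int_pow_pow comm_closed)
  also have "\<dots> = z [^] (i * v)" using 1 assms z by (simp add: int_pow_pow)
  finally show thesis using that by blast
qed

text \<open>If \<open>s = comm x y [^] (P ^ r)\<close> generated all these powers, then the power map would send \<open>x\<close> and
  \<open>y\<close> to \<open>s [^] i\<close> and \<open>s [^] j\<close>, so \<open>x [^] j \<otimes> y [^] (- i)\<close> would lie in its kernel, which forces
  \<open>s [^] i = \<one>\<close>.\<close>

lemma not_cyclic:
  assumes x: "x \<in> carrier G" and y: "y \<in> carrier G"
    and cyc: "\<And>g h. g \<in> carrier G \<Longrightarrow> h \<in> carrier G \<Longrightarrow>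
      \<exists>i::int. comm g h [^] (P ^ r) = (comm x y [^] (P ^ r)) [^] i"
  shows False
proof -
  define s where "s = comm x y [^] (P ^ r)"
  have sc: "s \<in> carrier G" using x y by (simp add: s_def)
  have sP: "s [^] P = \<one>" using comm_pow_exponent[OF x y] x y by (simp add: s_def int_pow_pow mult.commute)
  \<comment> \<open>The hypothesis \<open>cyc\<close> concerns single commutators. This subgroup
    carries it over to their products, that is, to the derived subgroup.\<close>
  let ?K = "{d \<in> group_center G. \<exists>i::int. d [^] (P ^ r) = s [^] i}"
  have "subgroup ?K G"
  proof
    show "?K \<subseteq> carrier G" using center_closed by auto
    have "\<one> [^] (P ^ r) = s [^] (0::int)" by simp
    then show "\<one> \<in> ?K" using subgroup.one_closed[OF center_subgroup] by blast
  next
    fix u v assume "u \<in> ?K" "v \<in> ?K"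
    then obtain i j :: int where u: "u \<in> group_center G" "u [^] (P ^ r) = s [^] i"
      and v: "v \<in> group_center G" "v [^] (P ^ r) = s [^] j" by blast
    have "(u \<otimes> v) [^] (P ^ r) = s [^] (i + j)"
      using u v sc by (simp add: center_mult_int_pow center_closed int_pow_mult)
    then show "u \<otimes> v \<in> ?K" using center_mult u(1) v(1) by blast
  next
    fix u assume "u \<in> ?K"
    then obtain i :: int where u: "u \<in> group_center G" "u [^] (P ^ r) = s [^] i" by blast
    have "inv u [^] (P ^ r) = s [^] (- i)"
      using u sc by (simp add: center_closed int_pow_inv int_pow_neg)
    then show "inv u \<in> ?K" using center_inv u(1) by blast
  qed
  then have DK: "derived G (carrier G) \<subseteq> ?K"
    by (rule derived_subset) (use cyc in \<open>auto simp: s_def\<close>)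
  show False
  proof (cases regular)
    case True
    have power_map: "\<exists>i::int. u [^] (P ^ (m + r)) = s [^] i" if u: "u \<in> carrier G" for u
    proof -
      have "u [^] (P ^ m) \<in> ?K" using DK pow_derived[OF u] by blast
      then show ?thesis using u by (simp add: int_pow_pow power_add)
    qed
    obtain i where i: "x [^] (P ^ (m + r)) = s [^] (i::int)" using power_map[OF x] by blast
    obtain j where j: "y [^] (P ^ (m + r)) = s [^] (j::int)" using power_map[OF y] by blast
    define h where "h = x [^] j \<otimes> y [^] (- i)"
    have hc: "h \<in> carrier G" using x y by (simp add: h_def)
    have "h [^] (P ^ (m + r)) = s [^] (i * j + j * - i)"
      unfolding h_def power_map_int_pow[OF True x y] using sc by (simp only: i j int_pow_pow int_pow_mult)
    then have "h [^] (P ^ (m + r)) = \<one>" by simp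
    then have hZ: "h [^] (P ^ r) \<in> group_center G" by (rule power_map_kernel[OF hc])
    have "comm x h [^] (P ^ r) = \<one>"
      using pow_center_iff[OF hc] hZ x comm_flip_pow[OF x hc, of "P ^ r"] hc by (simp add: int_pow_neg)
    moreover have "comm x h = comm x y [^] (- i)"
      unfolding h_def using x y by (simp add: comm_mult_right' comm_int_pow_right')
    ultimately have "s [^] (- i) = \<one>"
      using x y by (simp add: s_def int_pow_pow mult.commute)
    then have "x [^] (P ^ (m + r)) = \<one>"
      using i sc by (metis int_pow_closed int_pow_neg inv_eq_1_iff)
    then have "x [^] (P ^ r) \<in> group_center G" by (rule power_map_kernel[OF x])
    then have "s = \<one>" unfolding s_def using pow_center_iff[OF x] y by blast
    then have "comm g h [^] (P ^ r) = \<one>" if "g \<in> carrier G" "h \<in> carrier G" for g h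
      using cyc[OF that] by (auto simp: s_def[symmetric])
    then show False using exists_comm_pow_ne_one by blast
  next
    case False
    \<comment> \<open>Now the derived subgroup lies in \<open>{\<one>, s}\<close>. A noncentral
      \<open>h\<close> has square \<open>s\<close>, so its only possible conjugates are
      \<open>h\<close> and \<open>s \<otimes> h = inv h\<close>.\<close>
    then have reg: "P = 2" "m = 1" "r = 0" using not_regular by auto
    have K2: "d = \<one> \<or> d = s" if d: "d \<in> ?K" for d
    proof -
      obtain i :: int where i: "d = s [^] i" using d reg center_closed by auto
      have "P dvd i - (if even i then 0 else 1)" using reg by auto
      from int_pow_eq_if_dvd_diff[OF sc sP this] show ?thesis unfolding i using sc by (auto split: if_splits)
    qed
    obtain h where h: "h \<in> carrier G" "h \<notin> group_center G" using pow_not_center reg by auto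
    have "h [^] P \<in> ?K" using DK pow_derived[OF h(1)] reg by auto
    moreover have "h [^] P \<noteq> \<one>" using central_if_pow[OF h(1)] h(2) reg by auto
    ultimately have hs: "h [^] P = s" using K2 by blast
    then have hh: "h \<otimes> h = s" using h reg int_pow_mult[of h 1 1] by simp
    have "s \<otimes> s = \<one>" using sP reg sc int_pow_mult[of s 1 1] by simp
    then have "(s \<otimes> h) \<otimes> h = \<one>" using h sc hh by (simp add: m_assoc)
    then have sh: "s \<otimes> h = inv h" using h sc by (metis inv_equality m_closed)
    have "h \<in> group_center G"
    proof (rule central_if_fixed_or_inverted[OF h(1)])
      fix g assume g: "g \<in> carrier G"
      have gh: "g \<otimes> h = comm g h \<otimes> h \<otimes> g" using g h by (simp add: comm_def word_simps)
      have "comm g h \<in> ?K" using DK comm_in_derived[OF g h(1)] by blast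
      then have "comm g h = \<one> \<or> comm g h = s" using K2 by blast
      then show "g \<otimes> h = h \<otimes> g \<or> g \<otimes> h = inv h \<otimes> g" unfolding gh using sh h by auto
    qed
    then show False using h by blast
  qed
qed

text \<open>The \<open>P\<^sup>2\<close> elements \<open>c \<otimes> a [^] i \<otimes> b [^] j\<close> have nontrivial \<open>P ^ (m + r)\<close>-th powers, which lie in a
  group of order at most \<open>P\<^sup>2\<close>, so two of these powers coincide. If the power map is not a
  homomorphism, they are squares, and \<open>x \<otimes> x = y \<otimes> y\<close> makes \<open>y\<close> invert \<open>inv y \<otimes> x\<close>.\<close>

lemma collision:
  assumes abc [simp]: "a \<in> carrier G" "b \<in> carrier G" "c \<in> carrier G"
    and gen: "generate G {a, b, c} = carrier G"
    and ab: "comm a b [^] (P ^ r) = \<one>"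
  obtains i j :: int where "\<not> (P dvd i \<and> P dvd j)" "(a [^] i \<otimes> b [^] j) [^] (P ^ r) \<in> group_center G"
proof -
  define u where "u = comm b c [^] (P ^ r)"
  define v where "v = comm c a [^] (P ^ r)"
  have uv [simp]: "u \<in> carrier G" "v \<in> carrier G" by (simp_all add: u_def v_def)
  have uP: "u [^] P = \<one>" and vP: "v [^] P = \<one>"
    using comm_pow_exponent[of b c] comm_pow_exponent[of c a]
    by (simp_all add: u_def v_def int_pow_pow mult.commute)
  have flip: "comm c b [^] (P ^ r) = inv u" "comm b a [^] (P ^ r) = \<one>"
    using comm_flip_pow[of c b "P ^ r"] comm_flip_pow[of b a "P ^ r"] ab by (simp_all add: u_def int_pow_neg)
  define I where "I = {0..<P} \<times> {0..<P}"
  have finI: "finite I" by (simp add: I_def)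
  define F where "F = (\<lambda>(i, j). c \<otimes> a [^] (i::int) \<otimes> b [^] (j::int))"
  have Fc: "F p \<in> carrier G" for p by (simp add: F_def split: prod.split)
  define W where "W = (\<lambda>(i, j). u [^] (i::int) \<otimes> v [^] (j::int)) ` I"
  have FW: "F p [^] (P ^ (m + r)) \<in> W" for p
  proof -
    have "F p [^] (P ^ m) \<in> comm_words a b c"
      using pow_derived[OF Fc] derived_subset_comm_words[OF abc gen] by blast
    then obtain i j k where "F p [^] (P ^ m) = comm_word a b c i j k" unfolding comm_words_def by blast
    then have "F p [^] (P ^ (m + r)) = comm_word a b c i j k [^] (P ^ r)"
      using Fc by (simp add: power_add int_pow_pow[symmetric])
    also have "\<dots> = comm_word a b c (i * P ^ r) (j * P ^ r) (k * P ^ r)"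
      by (rule comm_word_int_pow[OF abc])
    also have "\<dots> = u [^] i \<otimes> v [^] j \<otimes> (comm a b [^] (P ^ r)) [^] k"
      by (simp add: comm_word_def u_def v_def int_pow_pow mult.commute)
    also have "\<dots> = u [^] i \<otimes> v [^] j" using ab by simp
    also have "u [^] i = u [^] (i mod P)"
      by (rule int_pow_eq_if_dvd_diff[OF _ uP]) (simp_all add: mod_eq_dvd_iff[symmetric])
    also have "v [^] j = v [^] (j mod P)"
      by (rule int_pow_eq_if_dvd_diff[OF _ vP]) (simp_all add: mod_eq_dvd_iff[symmetric])
    finally have "F p [^] (P ^ (m + r)) = (\<lambda>(i, j). u [^] (i::int) \<otimes> v [^] (j::int)) (i mod P, j mod P)" by simp
    moreover have "(i mod P, j mod P) \<in> I" using P_gt_1 by (simp add: I_def)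
    ultimately show ?thesis unfolding W_def by (metis imageI)
  qed
  \<comment> \<open>The exponent of \<open>c\<close> in \<open>F p\<close> is 1, so commutators with
    \<open>a\<close> and \<open>b\<close> would give \<open>v = \<one>\<close> and
    \<open>u = \<one>\<close>; then every commutator of generators would die at level
    \<open>P ^ r\<close>.\<close>
  have F1: "F p [^] (P ^ (m + r)) \<noteq> \<one>" for p
  proof
    assume "F p [^] (P ^ (m + r)) = \<one>"
    then have "F p [^] (P ^ r) \<in> group_center G" by (rule power_map_kernel[OF Fc])
    then have Z: "comm (F p) g [^] (P ^ r) = \<one>" if "g \<in> carrier G" for g
      using pow_center_iff[OF Fc] that by blast
    obtain i j where p: "p = (i, j)" by (cases p)
    have "comm (F p) a = comm c a \<otimes> comm b a [^] j"
      unfolding p F_def by (simp add: comm_mult_left' comm_int_pow_left')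
    then have "v \<otimes> (comm b a [^] (P ^ r)) [^] j = \<one>"
      using Z[of a] by (simp add: comm_mult_int_pow v_def int_pow_pow mult.commute)
    then have v1: "v = \<one>" using flip by simp
    have "comm (F p) b = comm c b \<otimes> comm a b [^] i"
      unfolding p F_def by (simp add: comm_mult_left' comm_int_pow_left')
    then have "inv u \<otimes> (comm a b [^] (P ^ r)) [^] i = \<one>"
      using Z[of b] flip by (simp add: comm_mult_int_pow int_pow_pow mult.commute)
    then have u1: "u = \<one>" using ab by (simp add: inv_eq_1_iff)
    show False
    proof (rule pow_trivial_contradiction[OF _ gen])
      fix s t assume "s \<in> {a, b, c}" "t \<in> {a, b, c}"
      then show "comm s t [^] (P ^ r) = \<one>"
        using u1 v1 ab flip comm_flip_pow[of a c "P ^ r"] by (auto simp: u_def v_def int_pow_neg)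
    qed simp
  qed
  have "\<not> inj_on (\<lambda>p. F p [^] (P ^ (m + r))) I"
  proof (rule pigeonhole)
    have fW: "finite W" using finI by (simp add: W_def)
    have "card ((\<lambda>p. F p [^] (P ^ (m + r))) ` I) \<le> card (W - {\<one>})"
      by (rule card_mono) (use FW F1 fW in auto)
    also have "\<one> \<in> W" unfolding W_def
      by (rule image_eqI[of _ _ "(0, 0)"]) (use P_gt_1 in \<open>simp_all add: I_def\<close>)
    then have "card (W - {\<one>}) < card W" using fW by (rule card_Diff1_less[rotated])
    also have "card W \<le> card I" unfolding W_def by (rule card_image_le[OF finI])
    finally show "card ((\<lambda>p. F p [^] (P ^ (m + r))) ` I) < card I" .
  qed
  then obtain i j i' j' where ij: "(i, j) \<in> I" "(i', j') \<in> I" "(i, j) \<noteq> (i', j')"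
    and eq: "F (i, j) [^] (P ^ (m + r)) = F (i', j') [^] (P ^ (m + r))"
    unfolding inj_on_def by auto
  define x where "x = F (i, j)"
  define y where "y = F (i', j')"
  have xy [simp]: "x \<in> carrier G" "y \<in> carrier G" by (simp_all add: x_def y_def Fc)
  define h where "h = inv y \<otimes> x"
  have hc [simp]: "h \<in> carrier G" by (simp add: h_def)
  \<comment> \<open>The factor \<open>c\<close> cancels: \<open>h\<close> and the word in
    \<open>a\<close> and \<open>b\<close> have the same commutators, which is all that membership in
    the centre depends on.\<close>
  have comm_h: "comm h g = comm (a [^] (i - i') \<otimes> b [^] (j - j')) g" if g [simp]: "g \<in> carrier G" for g
  proof -
    have "x = y \<otimes> h" by (simp add: h_def cancel_inv_right)
    then have 1: "comm x g = comm y g \<otimes> comm h g" by (simp add: comm_mult_left')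
    have e: "comm x g = comm c g \<otimes> comm a g [^] i \<otimes> comm b g [^] j"
      "comm y g = comm c g \<otimes> comm a g [^] i' \<otimes> comm b g [^] j'"
      by (simp_all add: x_def y_def F_def comm_mult_left' comm_int_pow_left')
    have "comm y g \<otimes> comm (a [^] (i - i') \<otimes> b [^] (j - j')) g
      = comm c g \<otimes> (comm a g [^] i' \<otimes> comm b g [^] j' \<otimes> (comm a g [^] (i - i') \<otimes> comm b g [^] (j - j')))"
      by (simp add: e comm_mult_left' comm_int_pow_left' m_assoc)
    also have "comm a g [^] i' \<otimes> comm b g [^] j' \<otimes> (comm a g [^] (i - i') \<otimes> comm b g [^] (j - j'))
       = comm a g [^] i' \<otimes> comm a g [^] (i - i') \<otimes> (comm b g [^] j' \<otimes> comm b g [^] (j - j'))"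
      by (rule center_mult_mult) (simp_all add: center_int_pow)
    also have "\<dots> = comm a g [^] i \<otimes> comm b g [^] j" by (simp add: int_pow_mult[symmetric])
    finally have "comm y g \<otimes> comm (a [^] (i - i') \<otimes> b [^] (j - j')) g = comm x g"
      by (simp add: e m_assoc)
    then show ?thesis unfolding 1 by simp
  qed
  have "h [^] (P ^ r) \<in> group_center G"
  proof (cases regular)
    case True
    have "h [^] (P ^ (m + r)) = inv y [^] (P ^ (m + r)) \<otimes> x [^] (P ^ (m + r))"
      unfolding h_def by (rule power_map_mult[OF True]) simp_all
    also have "\<dots> = \<one>" using eq unfolding x_def[symmetric] y_def[symmetric] by (simp add: int_pow_inv)
    finally show ?thesis by (rule power_map_kernel[OF hc])
  next
    case False
    then have reg: "P = 2" "m = 1" "r = 0" using not_regular by auto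
    have sq: "x \<otimes> x = y \<otimes> y"
      using eq int_pow_mult[of x 1 1] int_pow_mult[of y 1 1] unfolding x_def[symmetric] y_def[symmetric] reg
      by simp
    have yh: "y \<otimes> h = inv h \<otimes> y"
    proof -
      have "inv h \<otimes> y = inv x \<otimes> (y \<otimes> y)" by (simp add: h_def word_simps)
      also have "\<dots> = x" by (simp add: sq[symmetric] cancel_inv_left)
      finally show ?thesis by (simp add: h_def cancel_inv_right)
    qed
    \<comment> \<open>As \<open>comm a b\<close> is trivial here, \<open>a\<close> and
      \<open>b\<close> commute with \<open>h\<close>. So \<open>y\<close> acts on \<open>h\<close>
      as \<open>c\<close> does, and only the parity of the exponent of \<open>c\<close> in
      \<open>g\<close> matters.\<close>
    have ha: "comm a h = \<one>" and hb: "comm b h = \<one>"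
    proof -
      have "comm h a = \<one>" "comm h b = \<one>"
        using comm_h[of a] comm_h[of b] ab flip(2) reg by (simp_all add: comm_mult_left' comm_int_pow_left')
      then show "comm a h = \<one>" "comm b h = \<one>" by (simp_all add: comm_eq_one_iff)
    qed
    have yc: "comm y h = comm c h"
      using ha hb by (simp add: y_def F_def comm_mult_left' comm_int_pow_left')
    have ch: "comm c h \<otimes> h = inv h"
    proof -
      have "comm y h \<otimes> h = y \<otimes> h \<otimes> inv y" by (simp add: conj_eq_comm)
      also have "\<dots> = inv h" unfolding yh by (simp add: word_simps)
      finally show ?thesis by (simp add: yc)
    qed
    have "h \<in> group_center G"
    proof (rule central_if_fixed_or_inverted[OF hc])
      fix g assume g: "g \<in> carrier G"
      obtain i j k d where d: "d \<in> comm_words a b c" "g = word a b c i j k \<otimes> d"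
        by (rule word_decomposition[OF abc gen g])
      have "comm g h = comm c h [^] k"
        unfolding d(2) comm_word_decomposition[OF abc gen d(1) hc] using ha hb by simp
      also have "\<dots> = comm c h [^] (if even k then 0 else 1 :: int)"
        by (rule comm_pow_eq[OF abc(3) hc]) (use reg(1,3) in simp)
      finally have gh: "comm g h = \<one> \<or> comm g h = comm c h" by (cases "even k") simp_all
      have "g \<otimes> h = comm g h \<otimes> h \<otimes> g" using g by (simp add: comm_def word_simps)
      then have "comm g h \<otimes> h = h \<or> comm g h \<otimes> h = inv h" "g \<otimes> h = comm g h \<otimes> h \<otimes> g"
        using gh ch by auto
      then show "g \<otimes> h = h \<otimes> g \<or> g \<otimes> h = inv h \<otimes> g" by presburger
    qed
    then show ?thesis using reg by simp
  qed
  then have "(a [^] (i - i') \<otimes> b [^] (j - j')) [^] (P ^ r) \<in> group_center G"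
    using pow_center_iff[of h] pow_center_iff[of "a [^] (i - i') \<otimes> b [^] (j - j')"] comm_h by simp
  moreover have "\<not> (P dvd i - i' \<and> P dvd j - j')"
  proof
    assume "P dvd i - i' \<and> P dvd j - j'"
    then have "i mod P = i' mod P" "j mod P = j' mod P" by (simp_all add: mod_eq_dvd_iff)
    then show False using ij by (auto simp: I_def)
  qed
  ultimately show thesis using that by blast
qed

text \<open>Otherwise \<open>collision\<close> provides a nontrivial combination of \<open>a\<close>
  and \<open>b\<close> whose \<open>P ^ r\<close>-th power is central. Its commutator with
  \<open>c\<close> makes one of the two remaining generator commutators a power of the other at
  level \<open>P ^ r\<close>, against \<open>not_cyclic\<close>.\<close>

lemma comm_pow_nontrivial:
  assumes abc [simp]: "a \<in> carrier G" "b \<in> carrier G" "c \<in> carrier G"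
    and gen: "generate G {a, b, c} = carrier G"
  shows "comm a b [^] (P ^ r) \<noteq> \<one>"
proof
  assume ab: "comm a b [^] (P ^ r) = \<one>"
  obtain i j :: int where ij: "\<not> (P dvd i \<and> P dvd j)"
    and h: "(a [^] i \<otimes> b [^] j) [^] (P ^ r) \<in> group_center G"
    using collision[OF abc gen ab] by blast
  have all_word: "\<exists>i j. comm g h [^] (P ^ r) = (comm b c [^] (P ^ r)) [^] (i::int) \<otimes> (comm c a [^] (P ^ r)) [^] (j::int)"
    if gh: "g \<in> carrier G" "h \<in> carrier G" for g h
  proof -
    obtain i j k where "comm g h = comm_word a b c i j k"
      using comm_in_comm_words[OF abc gen gh] unfolding comm_words_def by blast
    then have "comm g h [^] (P ^ r) = comm_word a b c (i * P ^ r) (j * P ^ r) (k * P ^ r)"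
      by (simp add: comm_word_int_pow)
    also have "\<dots> = (comm b c [^] (P ^ r)) [^] i \<otimes> (comm c a [^] (P ^ r)) [^] j \<otimes> (comm a b [^] (P ^ r)) [^] k"
      by (simp add: comm_word_def int_pow_pow mult.commute)
    finally show ?thesis using ab by auto
  qed
  have "comm (a [^] i \<otimes> b [^] j) c [^] (P ^ r) = \<one>"
    using h pow_center_iff[of "a [^] i \<otimes> b [^] j"] by simp
  then have "comm a c [^] (i * P ^ r) \<otimes> comm b c [^] (j * P ^ r) = \<one>"
    by (simp add: comm_mult_left' comm_int_pow_left' center_mult_int_pow center_int_pow int_pow_pow)
  then have rel: "comm b c [^] (j * P ^ r) = comm c a [^] (i * P ^ r)"
    using comm_flip_pow[of a c "i * P ^ r"] by (simp add: int_pow_neg inv_equality inv_solve_left' )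
  show False
  proof (cases "P dvd j")
    case False
    obtain k :: int where k: "comm b c [^] (P ^ r) = (comm c a [^] (P ^ r)) [^] k"
      by (rule pow_reduce[OF _ _ False, of b c "comm c a [^] (P ^ r)" i])
        (use rel in \<open>simp_all add: int_pow_pow mult.commute\<close>)
    show False
    proof (rule not_cyclic[of c a])
      fix g h assume "g \<in> carrier G" "h \<in> carrier G"
      then obtain i j where "comm g h [^] (P ^ r) = (comm b c [^] (P ^ r)) [^] (i::int) \<otimes> (comm c a [^] (P ^ r)) [^] (j::int)"
        using all_word by blast
      also have "\<dots> = (comm c a [^] (P ^ r)) [^] (k * i + j)" by (simp add: k int_pow_pow int_pow_mult mult_ac)
      finally show "\<exists>i::int. comm g h [^] (P ^ r) = (comm c a [^] (P ^ r)) [^] i" by blast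
    qed simp_all
  next
    case True
    then have ni: "\<not> P dvd i" using ij by blast
    obtain k :: int where k: "comm c a [^] (P ^ r) = (comm b c [^] (P ^ r)) [^] k"
      by (rule pow_reduce[OF _ _ ni, of c a "comm b c [^] (P ^ r)" j])
        (use rel in \<open>simp_all add: int_pow_pow mult.commute\<close>)
    show False
    proof (rule not_cyclic[of b c])
      fix g h assume "g \<in> carrier G" "h \<in> carrier G"
      then obtain i j where "comm g h [^] (P ^ r) = (comm b c [^] (P ^ r)) [^] (i::int) \<otimes> (comm c a [^] (P ^ r)) [^] (j::int)"
        using all_word by blast
      also have "\<dots> = (comm b c [^] (P ^ r)) [^] (i + k * j)" by (simp add: k int_pow_pow int_pow_mult mult_ac)
      finally show "\<exists>i::int. comm g h [^] (P ^ r) = (comm b c [^] (P ^ r)) [^] i" by blast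
    qed simp_all
  qed
qed

section \<open>Change of generators and linear independence\<close>

lemma generate_replace:
  assumes abc: "a \<in> carrier G" "b \<in> carrier G" "c \<in> carrier G"
    and gen: "generate G {a, b, c} = carrier G"
  shows "generate G {a \<otimes> c [^] (s::int), b \<otimes> c [^] (t::int), c} = carrier G" (is "generate G ?S = _")
proof
  have S: "?S \<subseteq> carrier G" using abc by simp
  then show "generate G ?S \<subseteq> carrier G" using generate_in_carrier by blast
  have sub: "subgroup (generate G ?S) G" by (rule generate_is_subgroup[OF S])
  have c: "c \<in> generate G ?S" by (rule generate.incl) simp
  have "a \<otimes> c [^] s \<in> generate G ?S" "b \<otimes> c [^] t \<in> generate G ?S" by (rule generate.incl, simp)+
  then have "a \<otimes> c [^] s \<otimes> c [^] (- s) \<in> generate G ?S" "b \<otimes> c [^] t \<otimes> c [^] (- t) \<in> generate G ?S"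
    using subgroup.m_closed[OF sub] subgroup_int_pow_closed[OF sub c] by blast+
  then have "a \<in> generate G ?S" "b \<in> generate G ?S" using abc by (simp_all add: m_assoc int_pow_neg)
  then show "carrier G \<subseteq> generate G ?S"
    unfolding gen[symmetric] using generate_subgroup_incl[OF _ sub, of "{a, b, c}"] c by simp
qed

text \<open>If \<open>k\<close> had an inverse \<open>v\<close> modulo \<open>P\<close>, scaling the
  relation by \<open>v\<close> would turn its coordinates into \<open>(?s, ?t, 1)\<close>. These are
  the coordinates of \<open>comm ?a ?b\<close>, and \<open>?a\<close>, \<open>?b\<close>,
  \<open>c\<close> still generate, so \<open>comm_pow_nontrivial\<close> applies.\<close>

lemma comm_word_independent_last:
  assumes abc [simp]: "a \<in> carrier G" "b \<in> carrier G" "c \<in> carrier G"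
    and gen: "generate G {a, b, c} = carrier G"
    and rel: "comm_word a b c i j k [^] (P ^ r) = \<one>"
  shows "P dvd k"
proof (rule ccontr)
  assume "\<not> P dvd k"
  with prime_P have "coprime P k" by (rule prime_imp_coprime)
  then obtain u v where uv: "u * P + v * k = 1" using bezout_int[of P k] by auto
  let ?s = "i * v" and ?t = "j * v"
  let ?a = "a \<otimes> c [^] (- ?s)" and ?b = "b \<otimes> c [^] (- ?t)"
  let ?u = "comm b c [^] ?s" and ?v = "comm c a [^] ?t"
  have "comm ?a ?b = comm a b \<otimes> ?u \<otimes> ?v"
    using comm_flip_pow[of a c "- ?t"] comm_flip_pow[of c b "- ?s"]
    by (simp add: comm_mult_left' comm_mult_right' comm_int_pow_left' comm_int_pow_right')
  also have "\<dots> = ?u \<otimes> (?v \<otimes> comm a b)"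
    using center_commutes[of "comm a b" "?u \<otimes> ?v"] by (simp add: m_assoc)
  also have "\<dots> = comm_word a b c ?s ?t 1" by (simp add: comm_word_def m_assoc)
  finally have "comm ?a ?b = comm_word a b c ?s ?t 1" .
  then have "comm ?a ?b [^] (P ^ r) = comm_word a b c (?s * P ^ r) (?t * P ^ r) (P ^ r)"
    by (simp add: comm_word_int_pow)
  also have "\<dots> = comm_word a b c (?s * P ^ r) (?t * P ^ r) (k * v * P ^ r)"
  proof -
    have "P ^ r - k * v * P ^ r = P ^ r * (1 - v * k)" by (simp add: algebra_simps)
    also have "\<dots> = P ^ Suc r * u" unfolding uv[symmetric] by simp
    finally have "P ^ Suc r dvd P ^ r - k * v * P ^ r" by simp
    then have "comm a b [^] (P ^ r) = comm a b [^] (k * v * P ^ r)" by (rule comm_pow_eq[OF abc(1,2)])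
    then show ?thesis by (simp add: comm_word_def)
  qed
  also have "\<dots> = (comm_word a b c i j k [^] (P ^ r)) [^] v"
    by (simp add: comm_word_int_pow mult_ac)
  also have "\<dots> = \<one>" using rel by simp
  finally show False
    using comm_pow_nontrivial[of ?a ?b c] generate_replace[OF abc gen] by simp
qed

text \<open>Rotating the generators treats all three coordinates alike. Factors \<open>P\<close> are
  split off one by one: once \<open>P ^ s\<close> is removed, the power \<open>P ^ r\<close> of what
  remains is still a power of the given relation as long as \<open>s \<le> r\<close>.\<close>

lemma comm_word_independent:
  assumes abc [simp]: "a \<in> carrier G" "b \<in> carrier G" "c \<in> carrier G"
    and gen: "generate G {a, b, c} = carrier G"
    and rel: "comm_word a b c i j k = \<one>"
  shows "P ^ Suc r dvd i" "P ^ Suc r dvd j" "P ^ Suc r dvd k"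
proof -
  have gens: "generate G {b, c, a} = carrier G" "generate G {c, a, b} = carrier G"
    using gen by (simp_all add: insert_commute)
  have P_dvd: "P dvd i \<and> P dvd j \<and> P dvd k" if "comm_word a b c i j k [^] (P ^ r) = \<one>" for i j k
    using comm_word_independent_last[OF abc gen that]
      comm_word_independent_last[OF abc(2,3,1) gens(1), of j k i]
      comm_word_independent_last[OF abc(3,1,2) gens(2), of k i j]
      that comm_word_rotate[OF abc, of j k i] comm_word_rotate[OF abc(2,3,1), of k i j]
    by simp
  have "s \<le> Suc r \<Longrightarrow> P ^ s dvd i \<and> P ^ s dvd j \<and> P ^ s dvd k" for s
  proof (induction s)
    case (Suc s)
    then obtain i' j' k' where e: "i = P ^ s * i'" "j = P ^ s * j'" "k = P ^ s * k'"
      by (auto elim!: dvdE)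
    have "P ^ s dvd P ^ r" using Suc.prems by (simp add: le_imp_power_dvd)
    then obtain l where l: "P ^ r = P ^ s * l" by blast
    have "comm_word a b c i' j' k' [^] (P ^ r) = comm_word a b c i j k [^] l"
      by (simp add: comm_word_int_pow e l mult_ac)
    then have "P dvd i' \<and> P dvd j' \<and> P dvd k'" using P_dvd rel by simp
    then show ?case unfolding e by auto
  qed simp
  then show "P ^ Suc r dvd i" "P ^ Suc r dvd j" "P ^ Suc r dvd k" by blast+
qed

subsection \<open>Endomorphisms modulo the centre\<close>

text \<open>The relation \<open>comm (\<alpha> a) a = \<one>\<close> has coordinates
  \<open>(0, k, - j)\<close>, so independence removes \<open>b\<close> and \<open>c\<close> from
  \<alpha> \<open>a\<close> modulo the centre.\<close>

lemma endo_generator: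
  assumes abc [simp]: "a \<in> carrier G" "b \<in> carrier G" "c \<in> carrier G"
    and gen: "generate G {a, b, c} = carrier G" and \<alpha>: "\<alpha> \<in> hom G G"
  obtains l :: int where "\<And>g. g \<in> carrier G \<Longrightarrow> comm (\<alpha> a) g = comm a g [^] l"
proof -
  have \<alpha>a [simp]: "\<alpha> a \<in> carrier G" using hom_in_carrier[OF \<alpha>] by simp
  obtain i j k d where d: "d \<in> comm_words a b c" and \<alpha>a_eq: "\<alpha> a = word a b c i j k \<otimes> d"
    by (rule word_decomposition[OF abc gen \<alpha>a])
  have eq: "comm (\<alpha> a) g = comm a g [^] i \<otimes> comm b g [^] j \<otimes> comm c g [^] k" if "g \<in> carrier G" for g
    unfolding \<alpha>a_eq by (rule comm_word_decomposition[OF abc gen d that])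
  have "comm (\<alpha> a) a = \<one>" using commutes_endo[OF \<alpha> abc(1)] comm_eq_one_iff[of "\<alpha> a" a] by simp
  then have "comm_word a b c 0 k (- j) = \<one>"
    using eq[of a] comm_word_left[OF abc, of a i j k] comm_word_gen(1)[OF abc, of i j k] by simp
  then have dvd: "P ^ Suc r dvd k" "P ^ Suc r dvd j"
    using comm_word_independent[OF abc gen] by (blast, metis dvd_minus_iff)
  have "comm (\<alpha> a) g = comm a g [^] i" if g: "g \<in> carrier G" for g
    using eq[OF g] comm_pow_eq[OF abc(2) g, of j 0] comm_pow_eq[OF abc(3) g, of k 0] dvd g by simp
  then show thesis using that by blast
qed

text \<open>As for a linear map with only eigenvectors, the sum of two basis vectors is tested: for
  \<open>a \<otimes> b\<close> the cross terms leave
  \<open>comm a b [^] (l - l') = \<one>\<close>.\<close>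

lemma endo_generators_agree:
  assumes abc [simp]: "a \<in> carrier G" "b \<in> carrier G" "c \<in> carrier G"
    and gen: "generate G {a, b, c} = carrier G" and \<alpha>: "\<alpha> \<in> hom G G"
    and la: "\<And>g. g \<in> carrier G \<Longrightarrow> comm (\<alpha> a) g = comm a g [^] (l::int)"
    and lb: "\<And>g. g \<in> carrier G \<Longrightarrow> comm (\<alpha> b) g = comm b g [^] (l'::int)"
    and g: "g \<in> carrier G"
  shows "comm (\<alpha> b) g = comm b g [^] l"
proof -
  have \<alpha>c [simp]: "\<alpha> a \<in> carrier G" "\<alpha> b \<in> carrier G" using hom_in_carrier[OF \<alpha>] by simp_all
  have "comm (\<alpha> (a \<otimes> b)) (a \<otimes> b) = \<one>"
    using commutes_endo[OF \<alpha>, of "a \<otimes> b"] comm_eq_one_iff[of "\<alpha> (a \<otimes> b)" "a \<otimes> b"] hom_in_carrier[OF \<alpha>, of "a \<otimes> b"]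
    by simp
  then have "comm b a [^] l' \<otimes> comm a b [^] l = \<one>"
    by (simp add: hom_mult[OF \<alpha>] comm_mult_left' comm_mult_right' la lb)
  then have "comm_word a b c 0 0 (l - l') = \<one>"
    using comm_flip_pow[of b a l'] int_pow_mult[of "comm a b" "- l'" l] by (simp add: comm_word_def)
  then have "P ^ Suc r dvd l - l'" by (rule comm_word_independent(3)[OF abc gen])
  then show ?thesis using lb[OF g] comm_pow_eq[OF abc(2) g, of l l'] by simp
qed

lemma endo_power_mod_center:
  assumes abc [simp]: "a \<in> carrier G" "b \<in> carrier G" "c \<in> carrier G"
    and gen: "generate G {a, b, c} = carrier G" and \<alpha>: "\<alpha> \<in> hom G G"
  obtains l :: int where "\<And>x g. x \<in> carrier G \<Longrightarrow> g \<in> carrier G \<Longrightarrow> comm (\<alpha> x) g = comm x g [^] l"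
proof -
  have gens: "generate G {b, c, a} = carrier G" "generate G {c, a, b} = carrier G"
    "generate G {a, c, b} = carrier G"
    using gen by (simp_all add: insert_commute)
  obtain l where l: "\<And>g. g \<in> carrier G \<Longrightarrow> comm (\<alpha> a) g = comm a g [^] (l::int)"
    using endo_generator[OF abc gen \<alpha>] by blast
  obtain lb where lb: "\<And>g. g \<in> carrier G \<Longrightarrow> comm (\<alpha> b) g = comm b g [^] (lb::int)"
    using endo_generator[OF abc(2,3,1) gens(1) \<alpha>] by blast
  obtain lc where lc: "\<And>g. g \<in> carrier G \<Longrightarrow> comm (\<alpha> c) g = comm c g [^] (lc::int)"
    using endo_generator[OF abc(3,1,2) gens(2) \<alpha>] by blast
  have l_gen: "comm (\<alpha> s) g = comm s g [^] l" if "s \<in> {a, b, c}" "g \<in> carrier G" for s g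
    using that l endo_generators_agree[OF abc gen \<alpha> l lb]
      endo_generators_agree[OF abc(1,3,2) gens(3) \<alpha> l lc] by auto
  interpret \<alpha>: group_hom G G \<alpha> using \<alpha> by unfold_locales
  have "comm (\<alpha> x) g = comm x g [^] l" if x: "x \<in> carrier G" and g: "g \<in> carrier G" for x g
  proof -
    have "x \<in> generate G {a, b, c}" using x gen by simp
    then show ?thesis
    proof induction
      case one then show ?case using g by simp
    next
      case (incl h) then show ?case using l_gen g by blast
    next
      case (inv h)
      then have h: "h \<in> carrier G" by auto
      have "comm (inv (\<alpha> h)) g = inv (comm (\<alpha> h) g)" "comm (inv h) g = inv (comm h g)"
        using comm_int_pow_left'[of "\<alpha> h" g "-1"] comm_int_pow_left'[of h g "-1"] h g
        by (simp_all add: int_pow_neg)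
      then show ?case using l_gen[OF inv g] h g by (simp add: int_pow_inv)
    next
      case (eng h1 h2)
      then have "h1 \<in> carrier G" "h2 \<in> carrier G" using gen by auto
      then show ?case using eng.IH g by (simp add: comm_mult_left' comm_mult_int_pow)
    qed
  qed
  then show thesis using that by blast
qed

text \<open>Compare the two ways of computing \<open>\<alpha> (x [^] (P ^ m))\<close>: the endomorphism \<open>\<alpha>\<close> acts as the
  \<open>l\<close>-th power modulo the centre and as the \<open>l * l\<close>-th power on the derived subgroup.\<close>

lemma endo_exponent_idempotent:
  assumes \<alpha>: "\<alpha> \<in> hom G G"
    and l: "\<And>x g. x \<in> carrier G \<Longrightarrow> g \<in> carrier G \<Longrightarrow> comm (\<alpha> x) g = comm x g [^] (l::int)"
  shows "P ^ Suc r dvd l \<or> P ^ Suc r dvd l - 1"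
proof -
  interpret \<alpha>: group_hom G G \<alpha> using \<alpha> by unfold_locales
  let ?K = "{d \<in> group_center G. \<alpha> d = d [^] (l * l)}"
  have comm_\<alpha>: "\<alpha> (comm x y) = comm (\<alpha> x) (\<alpha> y)" if "x \<in> carrier G" "y \<in> carrier G" for x y
    using that by (simp add: comm_def)
  have "subgroup ?K G"
  proof
    show "?K \<subseteq> carrier G" using center_closed by auto
    show "\<one> \<in> ?K" using subgroup.one_closed[OF center_subgroup] by simp
  next
    fix u v assume "u \<in> ?K" "v \<in> ?K"
    then show "u \<otimes> v \<in> ?K" by (simp add: center_mult center_closed center_mult_int_pow)
  next
    fix u assume "u \<in> ?K"
    then show "inv u \<in> ?K" by (simp add: center_inv center_closed int_pow_inv)
  qed
  moreover have "comm x y \<in> ?K" if "x \<in> carrier G" "y \<in> carrier G" for x y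
  proof -
    have "\<alpha> (comm x y) = comm x (\<alpha> y) [^] l" using that by (simp add: comm_\<alpha> l)
    also have "comm x (\<alpha> y) = inv (comm (\<alpha> y) x)" using that by (simp add: inv_comm)
    also have "\<dots> = comm x y [^] l" using that by (simp add: l int_pow_inv[symmetric] inv_comm del: \<alpha>.hom_closed)
    finally show ?thesis using that by (simp add: int_pow_pow)
  qed
  ultimately have DK: "derived G (carrier G) \<subseteq> ?K" by (rule derived_subset)
  have pow_Z: "x [^] (l * (l - 1)) \<in> group_center G" if x: "x \<in> carrier G" for x
  proof -
    define z where "z = inv (x [^] l) \<otimes> \<alpha> x"
    have zc: "z \<in> carrier G" using x by (simp add: z_def)
    have \<alpha>x: "\<alpha> x = x [^] l \<otimes> z" using x by (simp add: z_def cancel_inv_right)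
    have "comm z g = \<one>" if g: "g \<in> carrier G" for g
    proof -
      have "comm x g [^] l \<otimes> comm z g = comm x g [^] l"
        using l[OF x g] x g zc unfolding \<alpha>x by (simp add: comm_mult_left' comm_int_pow_left')
      then show ?thesis using x g zc by simp
    qed
    then have zZ: "z \<in> group_center G" using zc by (simp add: mem_center_iff)
    have "x [^] (P ^ m) \<in> ?K" using DK pow_derived[OF x] by blast
    then have "\<alpha> x [^] (P ^ m) = (x [^] (P ^ m)) [^] (l * l)" using x by (simp add: \<alpha>.hom_int_pow)
    then have "x [^] (l * P ^ m) \<otimes> z [^] (P ^ m) = x [^] (P ^ m * (l * l))"
      using x zZ by (simp add: \<alpha>x center_mult_int_pow int_pow_pow)
    then have eq: "inv (x [^] (l * P ^ m)) \<otimes> x [^] (P ^ m * (l * l)) = z [^] (P ^ m)"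
      using x zc by (metis cancel_inv_left int_pow_closed)
    \<comment> \<open>Equating both values of the image of \<open>x [^] (P ^ m)\<close> shows that
      \<open>x [^] (l * (l - 1))\<close> and the central \<open>z\<close> have the same
      \<open>P ^ m\<close>-th power. So their quotient is killed by \<open>P ^ m\<close>, hence
      central.\<close>
    have "(x [^] (l * (l - 1)) \<otimes> inv z) [^] (P ^ m) = x [^] (- (l * P ^ m) + P ^ m * (l * l)) \<otimes> inv (z [^] (P ^ m))"
      using x zZ center_inv[OF zZ] zc by (simp add: center_mult_int_pow int_pow_pow int_pow_inv algebra_simps)
    also have "\<dots> = \<one>" using x zc eq by (simp only: int_pow_mult int_pow_neg) simp
    finally have "x [^] (l * (l - 1)) \<otimes> inv z \<in> group_center G"
      using central_if_pow x zc by simp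
    then have "x [^] (l * (l - 1)) \<otimes> inv z \<otimes> z \<in> group_center G" using center_mult zZ by blast
    then show ?thesis using x zc by (simp add: m_assoc)
  qed
  obtain x where x: "x \<in> carrier G" "x [^] (P ^ r) \<notin> group_center G" using pow_not_center by blast
  have "P ^ Suc r dvd l * (l - 1)"
    by (rule prime_pow_dvd_if_int_pow_mem[OF prime_P center_subgroup x(1) pow_center[OF x(1)] _ pow_Z[OF x(1)]])
      (use x(2) in simp)
  moreover have "coprime (P ^ Suc r) l \<or> coprime (P ^ Suc r) (l - 1)"
  proof (cases "P dvd l")
    case True
    then have "\<not> P dvd l - 1" using prime_P not_prime_unit dvd_diff_right_iff[of P l 1] by auto
    then have "coprime P (l - 1)" using prime_P prime_imp_coprime by blast
    then show ?thesis by simp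
  next
    case False
    then have "coprime P l" using prime_P prime_imp_coprime by blast
    then show ?thesis by simp
  qed
  ultimately show ?thesis
    using coprime_dvd_mult_left_iff coprime_dvd_mult_right_iff by blast
qed

text \<open>\<open>\<alpha> z = z \<otimes> w [^] (P ^ Suc r)\<close> with central \<open>w\<close> for every central \<open>z\<close>, so an element of the kernel is a
  \<open>P ^ k\<close>-th power of a central element for every \<open>k\<close>.\<close>

lemma endo_inj_if_trivial_mod_center:
  assumes abc [simp]: "a \<in> carrier G" "b \<in> carrier G" "c \<in> carrier G"
    and gen: "generate G {a, b, c} = carrier G" and \<alpha>: "\<alpha> \<in> hom G G"
    and triv: "\<And>x. x \<in> carrier G \<Longrightarrow> inv x \<otimes> \<alpha> x \<in> group_center G"
    and x: "x \<in> carrier G" "\<alpha> x = \<one>"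
  shows "x = \<one>"
proof -
  interpret \<alpha>: group_hom G G \<alpha> using \<alpha> by unfold_locales
  define \<delta> where "\<delta> y = inv y \<otimes> \<alpha> y" for y
  have \<delta>Z [simp]: "\<delta> y \<in> group_center G" if "y \<in> carrier G" for y using triv[OF that] by (simp add: \<delta>_def)
  have \<alpha>\<delta>: "\<alpha> y = y \<otimes> \<delta> y" if "y \<in> carrier G" for y using that by (simp add: \<delta>_def cancel_inv_right)
  have \<alpha>_comm: "\<alpha> (comm y z) = comm y z" if "y \<in> carrier G" "z \<in> carrier G" for y z
  proof -
    have "\<alpha> (comm y z) = comm (\<alpha> y) (\<alpha> z)" using that by (simp add: comm_def)
    also have "\<dots> = comm (y \<otimes> \<delta> y) (z \<otimes> \<delta> z)" using that by (simp add: \<alpha>\<delta>)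
    also have "\<dots> = comm y z"
      using that \<delta>Z[THEN center_closed]
      by (simp add: comm_mult_left' comm_mult_right' comm_center_left comm_center_right)
    finally show ?thesis .
  qed
  have step: "\<exists>w \<in> group_center G. \<alpha> z = z \<otimes> w [^] (P ^ Suc r)" if z: "z \<in> group_center G" for z
  proof -
    obtain i j k d where d: "d \<in> comm_words a b c" and z_eq: "z = word a b c i j k \<otimes> d"
      by (rule word_decomposition[OF abc gen center_closed[OF z]])
    have "comm z a = comm_word a b c 0 k (- j)" "comm z b = comm_word a b c (- k) 0 i"
      unfolding z_eq comm_word_decomposition[OF abc gen d abc(1)] comm_word_decomposition[OF abc gen d abc(2)]
      using comm_word_gen[OF abc, of i j k] comm_word_left[OF abc, of _ i j k] by simp_all
    then have "comm_word a b c 0 k (- j) = \<one>" "comm_word a b c (- k) 0 i = \<one>"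
      using comm_center_left[OF z] by simp_all
    \<comment> \<open>Central elements have generator exponents divisible by q; this is where
      independence enters.\<close>
    then have "P ^ Suc r dvd k" "P ^ Suc r dvd - j" "P ^ Suc r dvd i"
      using comm_word_independent[OF abc gen] by blast+
    then obtain i' j' k' where e: "i = i' * P ^ Suc r" "j = j' * P ^ Suc r" "k = k' * P ^ Suc r"
      by (metis dvd_minus_iff dvdE mult.commute)
    obtain i2 j2 k2 where d_eq: "d = comm_word a b c i2 j2 k2" using d unfolding comm_words_def by blast
    have \<alpha>d: "\<alpha> d = d" unfolding d_eq comm_word_def by (simp add: \<alpha>.hom_int_pow \<alpha>_comm)
    have dZ: "d \<in> group_center G" unfolding d_eq by simp
    have dc: "d \<in> carrier G" by (rule center_closed[OF dZ])
    have \<alpha>p: "\<alpha> (s [^] e) = s [^] e \<otimes> \<delta> s [^] e" if "s \<in> carrier G" for s and e :: int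
      unfolding \<alpha>.hom_int_pow[OF that] \<alpha>\<delta>[OF that] by (rule center_mult_int_pow[OF that \<delta>Z[OF that]])
    have Zp: "\<delta> s [^] (e::int) \<in> group_center G" if "s \<in> carrier G" for s e using that by (simp add: center_int_pow)
    \<comment> \<open>As \<open>i\<close>, \<open>j\<close>, \<open>k\<close> are q times
      \<open>i'\<close>, \<open>j'\<close>, \<open>k'\<close>, the total central correction of the
      word is the q-th power of \<open>w\<close>. The factor \<open>d\<close> is fixed.\<close>
    define w where "w = word (\<delta> a) (\<delta> b) (\<delta> c) i' j' k'"
    have wZ: "w \<in> group_center G" unfolding w_def word_def by (intro center_mult Zp abc)
    have \<delta>c: "\<delta> a \<in> carrier G" "\<delta> b \<in> carrier G" "\<delta> c \<in> carrier G" by (simp_all add: center_closed)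
    have "w [^] (P ^ Suc r) = (\<delta> a [^] i' \<otimes> \<delta> b [^] j') [^] (P ^ Suc r) \<otimes> (\<delta> c [^] k') [^] (P ^ Suc r)"
      unfolding w_def word_def by (rule center_mult_int_pow) (use \<delta>c Zp in simp_all)
    also have "(\<delta> a [^] i' \<otimes> \<delta> b [^] j') [^] (P ^ Suc r) = (\<delta> a [^] i') [^] (P ^ Suc r) \<otimes> (\<delta> b [^] j') [^] (P ^ Suc r)"
      by (rule center_mult_int_pow) (use \<delta>c Zp in simp_all)
    finally have "w [^] (P ^ Suc r) = \<delta> a [^] i \<otimes> \<delta> b [^] j \<otimes> \<delta> c [^] k"
      unfolding e using \<delta>c by (simp only: int_pow_pow)
    moreover have "\<alpha> (word a b c i j k) = word a b c i j k \<otimes> (\<delta> a [^] i \<otimes> \<delta> b [^] j \<otimes> \<delta> c [^] k)"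
    proof -
      have "\<alpha> (word a b c i j k) = a [^] i \<otimes> \<delta> a [^] i \<otimes> (b [^] j \<otimes> \<delta> b [^] j) \<otimes> (c [^] k \<otimes> \<delta> c [^] k)"
        by (simp add: word_def \<alpha>p)
      also have "a [^] i \<otimes> \<delta> a [^] i \<otimes> (b [^] j \<otimes> \<delta> b [^] j) = a [^] i \<otimes> b [^] j \<otimes> (\<delta> a [^] i \<otimes> \<delta> b [^] j)"
        by (rule center_mult_mult) (use Zp \<delta>c in simp_all)
      also have "\<dots> \<otimes> (c [^] k \<otimes> \<delta> c [^] k) = a [^] i \<otimes> b [^] j \<otimes> c [^] k \<otimes> (\<delta> a [^] i \<otimes> \<delta> b [^] j \<otimes> \<delta> c [^] k)"
        by (rule center_mult_mult) (use Zp \<delta>c center_mult in simp_all)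
      finally show ?thesis by (simp add: word_def)
    qed
    ultimately have "\<alpha> z = word a b c i j k \<otimes> w [^] (P ^ Suc r) \<otimes> d"
      unfolding z_eq using dc \<alpha>d by simp
    also have "\<dots> = z \<otimes> w [^] (P ^ Suc r)"
      using center_commutes[OF dZ, of "w [^] (P ^ Suc r)"] center_closed[OF wZ] dc by (simp add: z_eq m_assoc)
    finally show ?thesis using wZ by blast
  qed
  have xZ: "x \<in> group_center G" using \<delta>Z[OF x(1)] center_inv[of "inv x"] x by (simp add: \<delta>_def)
  have "\<exists>z \<in> group_center G. x = z [^] (P ^ k)" for k
  proof (induction k)
    case 0 then show ?case using xZ x(1) by (intro bexI[of _ x]) simp_all
  next
    case (Suc k)
    then obtain z where z: "z \<in> group_center G" "x = z [^] (P ^ k)" by blast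
    obtain w where w: "w \<in> group_center G" "\<alpha> z = z \<otimes> w [^] (P ^ Suc r)" using step[OF z(1)] by blast
    have c: "z \<in> carrier G" "w \<in> carrier G" using z(1) w(1) center_closed by auto
    have "\<one> = \<alpha> z [^] (P ^ k)" using x(2) c by (simp add: z(2) \<alpha>.hom_int_pow)
    also have "\<dots> = x \<otimes> w [^] (P ^ Suc r * P ^ k)"
      unfolding w(2) using c w(1) by (simp add: center_mult_int_pow center_int_pow z(2) int_pow_pow del: power_Suc)
    finally have "x = inv (w [^] (P ^ Suc r * P ^ k))"
      using c x(1) by (metis int_pow_closed inv_equality)
    \<comment> \<open>One factor \<open>P\<close> raises the exponent to \<open>Suc k\<close>; the
      remaining \<open>P ^ r\<close> is absorbed into the central witness.\<close>
    also have "P ^ Suc r * P ^ k = P ^ r * P ^ Suc k" by simp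
    also have "inv (w [^] (P ^ r * P ^ Suc k)) = (inv w [^] (P ^ r)) [^] (P ^ Suc k)"
      using c by (simp only: int_pow_pow int_pow_inv int_pow_closed inv_closed)
    finally show ?case using center_int_pow[OF center_inv[OF w(1)]] by blast
  qed
  moreover obtain k where "\<And>z. z \<in> carrier G \<Longrightarrow> z [^] (P ^ k) = \<one>" using exponent_exists by blast
  ultimately show ?thesis using center_closed by metis
qed

text \<open>The residue of \<open>l\<close> decides. If it is 0, the image is central and cannot be
  all of the nonabelian \<open>G\<close>. If it is 1, \<alpha> is the identity modulo the centre,
  injective, and by finiteness an automorphism.\<close>

lemma endo_dichotomy:
  assumes abc: "a \<in> carrier G" "b \<in> carrier G" "c \<in> carrier G"
    and gen: "generate G {a, b, c} = carrier G" and \<alpha>: "\<alpha> \<in> hom G G"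
  shows "(\<alpha> \<in> iso G G \<longrightarrow> central_automorphism G \<alpha>)
    \<and> (\<alpha> \<notin> iso G G \<longrightarrow> \<alpha> ` carrier G \<subseteq> group_center G)"
proof -
  interpret \<alpha>: group_hom G G \<alpha> using \<alpha> by unfold_locales
  obtain l where l: "\<And>x g. x \<in> carrier G \<Longrightarrow> g \<in> carrier G \<Longrightarrow> comm (\<alpha> x) g = comm x g [^] (l::int)"
    using endo_power_mod_center[OF abc gen \<alpha>] by blast
  consider "P ^ Suc r dvd l" | "P ^ Suc r dvd l - 1" using endo_exponent_idempotent[OF \<alpha> l] by blast
  then show ?thesis
  proof cases
    case 1
    have "comm (\<alpha> x) g = \<one>" if "x \<in> carrier G" "g \<in> carrier G" for x g
      using l[OF that] comm_pow_eq[OF that, of l 0] 1 by simp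
    then have im: "\<alpha> ` carrier G \<subseteq> group_center G" by (auto simp: mem_center_iff)
    have "\<alpha> \<notin> iso G G"
    proof
      assume "\<alpha> \<in> iso G G"
      then have "carrier G \<subseteq> group_center G" using im by (simp add: iso_def bij_betw_def)
      then show False using pow_not_center by blast
    qed
    then show ?thesis using im by blast
  next
    case 2
    have triv: "inv x \<otimes> \<alpha> x \<in> group_center G" if x: "x \<in> carrier G" for x
    proof -
      have "comm (inv x \<otimes> \<alpha> x) g = \<one>" if g: "g \<in> carrier G" for g
      proof -
        have "comm (\<alpha> x) g = comm x g" using l[OF x g] comm_pow_eq[OF x g 2] x g by simp
        moreover have "comm (inv x) g = inv (comm x g)"
          using comm_int_pow_left'[OF x g, of "-1"] x g by (simp add: int_pow_neg)
        ultimately show ?thesis using x g by (simp add: comm_mult_left')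
      qed
      then show ?thesis using x by (simp add: mem_center_iff)
    qed
    have "inj_on \<alpha> (carrier G)"
      unfolding \<alpha>.inj_on_one_iff using endo_inj_if_trivial_mod_center[OF abc gen \<alpha> triv] by blast
    moreover have "\<alpha> ` carrier G = carrier G"
      using \<open>inj_on \<alpha> (carrier G)\<close> finite_G by (intro endo_inj_surj) auto
    ultimately have "\<alpha> \<in> iso G G" using \<alpha> by (simp add: iso_def bij_betw_def)
    then show ?thesis using triv by (simp add: central_automorphism_def)
  qed
qed

end

theorem lemma2p7:
  fixes G :: "('a, 'b) monoid_scheme" (structure)
    and p :: nat
    and \<alpha> :: "'a \<Rightarrow> 'a"
  assumes "Factorial_Ring.prime p"
    and "finite (carrier G)"
    and "pE_group p G"
    and "\<exists>a \<in> carrier G. \<exists>b \<in> carrier G. \<exists>c \<in> carrier G. generate G {a, b, c} = carrier G"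
    and "\<alpha> \<in> hom G G"
  shows "(\<alpha> \<in> iso G G \<longrightarrow> central_automorphism G \<alpha>) \<and>
         (\<alpha> \<notin> iso G G \<longrightarrow> \<alpha> ` carrier G \<subseteq> group_center G)"
proof -
  have grp: "group G" using assms(3) by (simp add: pE_group_def p_group_def)
  interpret group G by (rule grp)
  interpret E_p_group G "int p"
  proof
    show "Factorial_Ring.prime (int p)" using assms(1) by simp
    show "finite (carrier G)" by (rule assms(2))
  next
    fix x assume x: "x \<in> carrier G"
    then obtain n where "ord x = p ^ n" using assms(3) by (auto simp: pE_group_def p_group_def)
    then have "x [^] (int p ^ n) = \<one>" using pow_ord_eq_1[OF x] int_pow_int[where G = G and x = x and n = "p ^ n"] by simp
    then show "\<exists>k. x [^] (int p ^ k) = \<one>" by blast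
  next
    fix \<phi> x assume "\<phi> \<in> hom G G" "x \<in> carrier G"
    then show "x \<otimes> \<phi> x = \<phi> x \<otimes> x" using assms(3) unfolding pE_group_def E_group_def by blast
  qed
  obtain a b c where abc: "a \<in> carrier G" "b \<in> carrier G" "c \<in> carrier G"
    and gen: "generate G {a, b, c} = carrier G" using assms(4) by blast
  interpret \<alpha>: group_hom G G \<alpha> using assms(5) by unfold_locales
  show ?thesis
  \<comment> \<open>In an abelian group both claims are immediate, and there is no \<open>r\<close>
    with q = \<open>P ^ Suc r\<close>.\<close>
  proof (cases "carrier G \<subseteq> group_center G")
    case True
    then show ?thesis by (auto simp: central_automorphism_def)
  next
    case False
    obtain m where m: "\<And>x. x \<in> carrier G \<Longrightarrow> x [^] (int p ^ m) \<in> derived G (carrier G)"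
      "\<And>u. u \<in> carrier G \<Longrightarrow> u [^] (int p ^ m) = \<one> \<Longrightarrow> u \<in> group_center G"
      using central_if_pow_exponent_abelianization by blast
    define Q where "Q s \<longleftrightarrow> (\<forall>x \<in> carrier G. x [^] (int p ^ s) \<in> group_center G)" for s
    obtain e where "\<And>x. x \<in> carrier G \<Longrightarrow> x [^] (int p ^ e) = \<one>" using exponent_exists by blast
    then have "Q e" using subgroup.one_closed[OF center_subgroup] by (simp add: Q_def)
    then have Q: "Q (LEAST s. Q s)" by (rule LeastI)
    moreover have "\<not> Q 0" using False by (auto simp: Q_def)
    ultimately have "(LEAST s. Q s) \<noteq> 0" by metis
    then obtain r where r: "(LEAST s. Q s) = Suc r" using not0_implies_Suc by blast
    then have "\<not> Q r" using not_less_Least[of r Q] by simp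
    interpret class_two_E_p_group G "int p" m r
    proof
      show "\<exists>x\<in>carrier G. x [^] (int p ^ r) \<notin> group_center G" using \<open>\<not> Q r\<close> by (simp add: Q_def)
      show "x [^] (int p ^ Suc r) \<in> group_center G" if "x \<in> carrier G" for x
        using Q that unfolding r by (simp add: Q_def)
    qed (use comm_central[OF abc gen] m in auto)
    show ?thesis by (rule endo_dichotomy[OF abc gen assms(5)])
  qed
qed

end
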